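(* Let $n\ge 1$ and let $G$ be a subgroup of $S_n$ that is generated by elements $\sigma_1^{r_1},\sigma_2^{r_2},\dots,\sigma_t^{r_t}$, where $\sigma_1,\dots,\sigma_t$ are pairwise disjoint cycles in $S_n$ and $r_1,\dots,r_t$ are integers. Then the quotient poset $B_n/G$ is a symmetric chain order.
   Context: A finite poset $P$ is ranked if it has a minimum element $0_P$ and, for every $x\in P$, all saturated chains from $0_P$ to $x$ have the same length $r(x)$ (number of elements minus one); $r(P)=\max_x r(x)$. In a ranked poset a chain $x_1<x_2<\dots<x_k$ is symmetric if it is saturated (each $x_{i+1}$ covers $x_i$) and $r(x_1)+r(x_k)=r(P)$. A symmetric chain decomposition (SCD) of $P$ is a partition of $P$ into symmetric chains; $P$ is a symmetric chain order (SCO) if it has an SCD. $B_n$ is the Boolean lattice of all subsets of $[n]=\{1,\dots,n\}$ ordered by inclusion. $S_n$ acts on $B_n$ by $\sigma(A)=\{\sigma(a):a\in A\}$. For a subgroup $G\le S_n$, the quotient $B_n/G$ is the set of orbits $[A]=\{\sigma(A):\sigma\in G\}$, $A\in B_n$, ordered by $[A]\le[B]$ iff $X\subseteq Y$ for some $X\in[A]$, $Y\in[B]$; its rank function is $r([A])=|A|$. *)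

theory Defs
  imports "HOL-Combinatorics.Cycles"
begin

definition is_cycle_in :: "nat \<Rightarrow> (nat \<Rightarrow> nat) \<Rightarrow> bool" where
  "is_cycle_in n s \<longleftrightarrow> s permutes {1..n} \<and>
     (\<exists>cs. distinct cs \<and> set cs \<subseteq> {1..n} \<and> s = cycle_of_list cs)"

definition supp_perm :: "(nat \<Rightarrow> nat) \<Rightarrow> nat set" where
  "supp_perm s = {x. s x \<noteq> x}"

definition perm_zpow :: "(nat \<Rightarrow> nat) \<Rightarrow> int \<Rightarrow> (nat \<Rightarrow> nat)" where
  "perm_zpow s k = (if 0 \<le> k then s ^^ nat k else (inv s) ^^ nat (- k))"

inductive_set gen_group :: "(nat \<Rightarrow> nat) set \<Rightarrow> (nat \<Rightarrow> nat) set" for S where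
  gen_id: "id \<in> gen_group S"
| gen_mult: "s \<in> S \<Longrightarrow> g \<in> gen_group S \<Longrightarrow> s \<circ> g \<in> gen_group S"
| gen_inv: "s \<in> S \<Longrightarrow> g \<in> gen_group S \<Longrightarrow> inv s \<circ> g \<in> gen_group S"

definition orbit_set :: "(nat \<Rightarrow> nat) set \<Rightarrow> nat set \<Rightarrow> nat set set" where
  "orbit_set G A = (\<lambda>s. s ` A) ` G"

definition quot_carrier :: "nat \<Rightarrow> (nat \<Rightarrow> nat) set \<Rightarrow> nat set set set" where
  "quot_carrier n G = {orbit_set G A | A. A \<subseteq> {1..n}}"

definition quot_le :: "nat set set \<Rightarrow> nat set set \<Rightarrow> bool" where
  "quot_le O1 O2 \<longleftrightarrow> (\<exists>X\<in>O1. \<exists>Y\<in>O2. X \<subseteq> Y)"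

definition quot_rank :: "nat set set \<Rightarrow> nat" where
  "quot_rank O1 = card (SOME X. X \<in> O1)"

definition covers :: "'a set \<Rightarrow> ('a \<Rightarrow> 'a \<Rightarrow> bool) \<Rightarrow> 'a \<Rightarrow> 'a \<Rightarrow> bool" where
  "covers P le x y \<longleftrightarrow> x \<in> P \<and> y \<in> P \<and> le x y \<and> x \<noteq> y \<and>
     \<not> (\<exists>z\<in>P. le x z \<and> le z y \<and> z \<noteq> x \<and> z \<noteq> y)"

(* symmetric chain x_1 < ... < x_k (as a list) in a ranked poset with rank function r, r(P) = R *)
definition symmetric_chain ::
  "'a set \<Rightarrow> ('a \<Rightarrow> 'a \<Rightarrow> bool) \<Rightarrow> ('a \<Rightarrow> nat) \<Rightarrow> nat \<Rightarrow> 'a list \<Rightarrow> bool" where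
  "symmetric_chain P le r R xs \<longleftrightarrow> xs \<noteq> [] \<and> set xs \<subseteq> P \<and>
     (\<forall>i. Suc i < length xs \<longrightarrow> covers P le (xs ! i) (xs ! Suc i)) \<and>
     r (hd xs) + r (last xs) = R"

definition is_SCD ::
  "'a set \<Rightarrow> ('a \<Rightarrow> 'a \<Rightarrow> bool) \<Rightarrow> ('a \<Rightarrow> nat) \<Rightarrow> nat \<Rightarrow> 'a list set \<Rightarrow> bool" where
  "is_SCD P le r R C \<longleftrightarrow> (\<forall>xs\<in>C. symmetric_chain P le r R xs) \<and>
     (\<forall>xs\<in>C. \<forall>ys\<in>C. xs \<noteq> ys \<longrightarrow> set xs \<inter> set ys = {}) \<and>
     (\<Union>xs\<in>C. set xs) = P"

definition is_SCO :: "'a set \<Rightarrow> ('a \<Rightarrow> 'a \<Rightarrow> bool) \<Rightarrow> ('a \<Rightarrow> nat) \<Rightarrow> nat \<Rightarrow> bool" where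
  "is_SCO P le r R \<longleftrightarrow> (\<exists>C. is_SCD P le r R C)"

end

theory Submission
  imports Defs "HOL-Library.Nat_Bijection"
begin

text \<open>
  Read a subset of a cycle of length \<open>m\<close> as a cyclic word, elements being closing and non-elements
  opening brackets, and call an opening bracket without partner free. A set \<open>A\<close> with
  \<open>2 * card A \<le> m\<close> has \<open>m - 2 * card A\<close> free points, and adding all of them is a
  rotation-equivariant bijection \<open>theta\<close> from rank \<open>k\<close> to rank \<open>m - k\<close>. If \<open>B\<close> arises from \<open>A\<close> by adding
  one free point, then \<open>A \<subset> B \<subseteq> theta B \<subset> theta A\<close>, so it suffices to match each orbit of rank
  \<open>k < m div 2\<close> injectively with an orbit of rank \<open>k + 1\<close> by adding a free point to some representative.
  Cut the cycle open at a base point. Adding the first free point is the Greene-Kleitman map, which is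
  injective on sets, and it yields the lexicographically largest outcome of adding a free point.
  Sending an orbit to the largest such outcome over all its members is therefore injective on orbits:
  the outcome is the largest member of its own orbit, hence determined by that orbit.

  For disjoint cycles the quotient is a product, and products of symmetric chains split into
  symmetric hooks. Chain decompositions are encoded by a function \<open>c\<close> giving the label of the
  chain through the orbit of a set, and the rank \<open>lo\<close> at which the chain of a given label starts.
\<close>

section \<open>Orbits of generated groups\<close>

lemma gen_group_comp:
  "g \<in> gen_group S \<Longrightarrow> h \<in> gen_group S \<Longrightarrow> g \<circ> h \<in> gen_group S"
  by (induction rule: gen_group.induct) (auto simp: comp_assoc intro: gen_group.intros)

lemma gen_group_mono: "S \<subseteq> T \<Longrightarrow> g \<in> gen_group S \<Longrightarrow> g \<in> gen_group T"
  by (rotate_tac 1, induction rule: gen_group.induct) (auto intro: gen_group.intros)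

lemma gen_group_permutes:
  assumes "g \<in> gen_group S" "\<And>s. s \<in> S \<Longrightarrow> s permutes X"
  shows "g permutes X"
  using assms
  by (induction rule: gen_group.induct) (auto intro: permutes_compose permutes_inv permutes_id)

text \<open>Inverting \<open>s \<circ> g\<close> puts the inverse generator on the right, while the
  inductive rules multiply on the left; closure under composition bridges this.\<close>

lemma gen_group_inv:
  assumes "g \<in> gen_group S" "\<And>s. s \<in> S \<Longrightarrow> s permutes X"
  shows "inv g \<in> gen_group S"
  using assms(1)
proof (induction rule: gen_group.induct)
  case gen_id
  show ?case unfolding inv_id by (rule gen_group.gen_id)
next
  case (gen_mult s g)
  have "inv (s \<circ> g) = inv g \<circ> inv s"
    using gen_mult assms(2) gen_group_permutes[of g S X] by (meson o_inv_distrib permutes_bij)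
  moreover have "inv s \<in> gen_group S"
    using gen_group.gen_inv[OF gen_mult(1) gen_group.gen_id] by simp
  ultimately show ?case using gen_mult gen_group_comp by metis
next
  case (gen_inv s g)
  have "inv (inv s \<circ> g) = inv g \<circ> s"
    using gen_inv assms(2) gen_group_permutes[of g S X]
    by (metis bij_imp_bij_inv inv_inv_eq o_inv_distrib permutes_bij)
  moreover have "s \<in> gen_group S"
    using gen_group.gen_mult[OF gen_inv(1) gen_group.gen_id] by simp
  ultimately show ?case using gen_inv gen_group_comp by metis
qed

definition same_orbit :: "(nat \<Rightarrow> nat) set \<Rightarrow> nat set \<Rightarrow> nat set \<Rightarrow> bool" where
  "same_orbit S A B \<longleftrightarrow> (\<exists>g\<in>gen_group S. B = g ` A)"

lemma same_orbit_refl: "same_orbit S A A"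
  unfolding same_orbit_def by (metis gen_group.gen_id image_id id_apply)

lemma same_orbit_trans: "same_orbit S A B \<Longrightarrow> same_orbit S B C \<Longrightarrow> same_orbit S A C"
  unfolding same_orbit_def by (metis gen_group_comp image_comp)

lemma same_orbit_sym:
  assumes "same_orbit S A B" "\<And>s. s \<in> S \<Longrightarrow> s permutes X"
  shows "same_orbit S B A"
proof -
  obtain g where g: "g \<in> gen_group S" "B = g ` A" using assms(1) unfolding same_orbit_def by auto
  have "inv g ` B = A"
    using g gen_group_permutes[OF g(1) assms(2)]
    by (metis image_inv_f_f permutes_inj)
  then show ?thesis using gen_group_inv[OF g(1) assms(2)] unfolding same_orbit_def by blast
qed

text \<open>Designed so that each label class is a symmetric chain of orbits: the clauses provide in
  turn well-definedness on orbits, at most one orbit per rank, comparability of neighbours, and the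
  interval of ranks from \<open>lo\<close> to \<open>card X - lo\<close>. Labels are natural numbers
  so that products can pair them.\<close>

definition orbit_scd ::
    "nat set \<Rightarrow> (nat \<Rightarrow> nat) set \<Rightarrow> (nat set \<Rightarrow> nat) \<Rightarrow> (nat \<Rightarrow> nat) \<Rightarrow> bool" where
  "orbit_scd X S c lo \<longleftrightarrow>
     (\<forall>s\<in>S. \<forall>A\<subseteq>X. c (s ` A) = c A) \<and>
     (\<forall>A\<subseteq>X. \<forall>B\<subseteq>X. c A = c B \<and> card A = card B \<longrightarrow> same_orbit S A B) \<and>
     (\<forall>A\<subseteq>X. \<forall>B\<subseteq>X. c A = c B \<and> card B = Suc (card A) \<longrightarrow>
        (\<exists>B'. same_orbit S B B' \<and> A \<subseteq> B')) \<and>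
     (\<forall>A\<subseteq>X. lo (c A) \<le> card A \<and> card A + lo (c A) \<le> card X \<and>
        (\<forall>k. lo (c A) \<le> k \<and> k + lo (c A) \<le> card X \<longrightarrow> (\<exists>B\<subseteq>X. c B = c A \<and> card B = k)))"

section \<open>Free points of a cyclic word\<close>

text \<open>The acting permutations are tied to the cycle by commutation instead of being powers of
  it. This also admits an empty \<open>S\<close>, which will serve for the points outside all
  cycles.\<close>

locale cycle_action =
  fixes X :: "nat set" and \<sigma> :: "nat \<Rightarrow> nat" and S :: "(nat \<Rightarrow> nat) set"
  assumes finX: "finite X" and nonempty: "X \<noteq> {}"
    and perm: "\<sigma> permutes X"
    and cyc: "\<And>b. b \<in> X \<Longrightarrow> bij_betw (\<lambda>k. (\<sigma> ^^ k) b) {..<card X} X"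
    and S_perm: "\<And>s. s \<in> S \<Longrightarrow> s permutes X"
    and S_comm: "\<And>s. s \<in> S \<Longrightarrow> s \<circ> \<sigma> = \<sigma> \<circ> s"
begin

abbreviation "m \<equiv> card X"
abbreviation orb (infix "\<simeq>" 50) where "A \<simeq> B \<equiv> same_orbit S A B"

lemma m_pos: "m > 0"
  using finX nonempty by (simp add: card_gt_0_iff)

lemma pow_in: "b \<in> X \<Longrightarrow> (\<sigma> ^^ k) b \<in> X"
  by (induction k) (auto simp: permutes_in_image[OF perm])

lemma pow_inj: "(\<sigma> ^^ k) a = (\<sigma> ^^ k) b \<Longrightarrow> a = b"
  using perm by (metis injD inj_fn permutes_inj)

lemma reach:
  assumes "b \<in> X" "x \<in> X" obtains p where "p < m" "x = (\<sigma> ^^ p) b"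
  using cyc[OF assms(1)] assms(2) unfolding bij_betw_def by blast

lemma pow_m: assumes "b \<in> X" shows "(\<sigma> ^^ m) b = b"
proof -
  obtain k where k: "k < m" "(\<sigma> ^^ m) b = (\<sigma> ^^ k) b"
    using reach[OF assms pow_in[OF assms]] by metis
  have "(\<sigma> ^^ m) b = (\<sigma> ^^ k) ((\<sigma> ^^ (m - k)) b)"
    using k(1) by (metis comp_apply funpow_add le_add_diff_inverse less_imp_le_nat)
  then have e: "(\<sigma> ^^ (m - k)) b = (\<sigma> ^^ 0) b" using k pow_inj[of k] by simp
  \<comment> \<open>Otherwise \<open>m - k\<close> and \<open>0\<close> are two exponents below
    \<open>m\<close> that send \<open>b\<close> to the same point.\<close>
  have "k = 0"
  proof (rule ccontr)
    assume "k \<noteq> 0"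
    then have "m - k < m" "0 < m" "m - k \<noteq> 0" using k by auto
    then show False
      using inj_onD[OF bij_betw_imp_inj_on[OF cyc[OF assms]] e] by auto
  qed
  then show ?thesis using k by simp
qed

definition height :: "nat set \<Rightarrow> nat \<Rightarrow> nat \<Rightarrow> int" where
  "height A b n = (\<Sum>k<n. if (\<sigma> ^^ k) b \<in> A then 1 else - 1)"

text \<open>The walk from \<open>b\<close> drops at once and never returns to its level, so the
  opening bracket at \<open>b\<close> is never closed. Letting \<open>n\<close> exceed
  \<open>m\<close> reads the word periodically.\<close>

definition free :: "nat set \<Rightarrow> nat set" where
  "free A = {b \<in> X. \<forall>n>0. height A b n < 0}"

lemma height_0 [simp]: "height A b 0 = 0"
  by (simp add: height_def)

lemma height_Suc [simp]: "height A b (Suc n) = height A b n + (if (\<sigma> ^^ n) b \<in> A then 1 else - 1)"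
  by (simp add: height_def)

lemma height_add: "height A b (n + k) = height A b n + height A ((\<sigma> ^^ n) b) k"
proof (induction k)
  case (Suc k)
  have "(\<sigma> ^^ (n + k)) b = (\<sigma> ^^ k) ((\<sigma> ^^ n) b)"
    by (metis add.commute comp_apply funpow_add)
  then show ?case using Suc by simp
qed simp

lemma height_period:
  assumes "b \<in> X" "A \<subseteq> X" shows "height A b m = 2 * int (card A) - int m"
proof -
  have "height A b m = (\<Sum>x\<in>X. if x \<in> A then 1 else - 1)"
    unfolding height_def
    using sum.reindex_bij_betw[OF cyc[OF assms(1)], of "\<lambda>x. if x \<in> A then 1 else - 1 :: int"]
    by simp
  also have "\<dots> = (\<Sum>x\<in>A. 1) + (\<Sum>x\<in>X - A. - 1)"
    using assms(2) finX
    by (subst sum.subset_diff[OF assms(2)]) auto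
  also have "\<dots> = 2 * int (card A) - int m"
    using card_Diff_subset[OF finite_subset[OF assms(2) finX] assms(2)] card_mono[OF finX assms(2)]
    by simp
  finally show ?thesis .
qed

text \<open>Each turn adds the drift \<open>2 * card A - m\<close>, negative below the middle rank;
  this controls the walk beyond its first period.\<close>

lemma height_periods:
  assumes "b \<in> X" "A \<subseteq> X"
  shows "height A b (q * m + e) = int q * (2 * int (card A) - int m) + height A b e"
proof (induction q)
  case (Suc q)
  have "height A b (Suc q * m + e) = height A b m + height A b (q * m + e)"
    using height_add[of A b m "q * m + e"] pow_m[OF assms(1)] by (simp add: add.assoc)
  then show ?case using Suc height_period[OF assms] by (simp add: algebra_simps)
qed simp

lemma freeD: "b \<in> free A \<Longrightarrow> n > 0 \<Longrightarrow> height A b n < 0"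
  by (simp add: free_def)

lemma free_sub: "free A \<subseteq> X"
  by (auto simp: free_def)

lemma free_disj: "free A \<inter> A = {}"
proof -
  have "b \<notin> A" if "b \<in> free A" for b
    using freeD[OF that, of 1] by (auto split: if_splits)
  then show ?thesis by auto
qed

text \<open>Restarting the walk at \<open>p\<close> subtracts the height there, so freeness becomes
  domination over all later positions of one walk with a fixed start.\<close>

lemma free_pow_iff:
  assumes "b \<in> X"
  shows "(\<sigma> ^^ p) b \<in> free A \<longleftrightarrow> (\<forall>e>p. height A b e < height A b p)"
proof
  assume L: "(\<sigma> ^^ p) b \<in> free A"
  show "\<forall>e>p. height A b e < height A b p"
  proof (intro allI impI)
    fix e assume "p < e"
    then show "height A b e < height A b p"
      using freeD[OF L, of "e - p"] height_add[of A b p "e - p"] by simp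
  qed
next
  assume R: "\<forall>e>p. height A b e < height A b p"
  have "height A ((\<sigma> ^^ p) b) n < 0" if "n > 0" for n
    using R[rule_format, of "p + n"] that height_add[of A b p n] by simp
  then show "(\<sigma> ^^ p) b \<in> free A" using pow_in[OF assms] by (simp add: free_def)
qed

lemma height_mono: "A \<subseteq> B \<Longrightarrow> height A b n \<le> height B b n"
  unfolding height_def by (rule sum_mono) auto

lemma free_antimono: "A \<subseteq> B \<Longrightarrow> free B \<subseteq> free A"
  unfolding free_def using height_mono[of A B] by (blast intro: le_less_trans)

section \<open>Equivariance under the group\<close>

lemma gen_comm: assumes "g \<in> gen_group S" shows "g (\<sigma> x) = \<sigma> (g x)"
  using assms
proof (induction arbitrary: x rule: gen_group.induct)
  case (gen_mult s g)
  then show ?case using fun_cong[OF S_comm[OF gen_mult(1)]] by simp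
next
  case (gen_inv s g)
  have "s (\<sigma> y) = \<sigma> (s y)" for y using fun_cong[OF S_comm[OF gen_inv(1)], of y] by simp
  then have "inv s (\<sigma> y) = \<sigma> (inv s y)" for y
    using S_perm[OF gen_inv(1)] by (metis permutes_inverses)
  then show ?case using gen_inv by simp
qed simp

lemma gen_perm: "g \<in> gen_group S \<Longrightarrow> g permutes X"
  using gen_group_permutes S_perm by blast

lemma gen_comm_pow: "g \<in> gen_group S \<Longrightarrow> g ((\<sigma> ^^ k) x) = (\<sigma> ^^ k) (g x)"
  by (induction k) (auto simp: gen_comm)

lemma height_equivariant:
  assumes "g \<in> gen_group S" shows "height (g ` A) (g b) n = height A b n"
  unfolding height_def gen_comm_pow[OF assms, symmetric]
  using inj_image_mem_iff[OF permutes_inj[OF gen_perm[OF assms]]] by simp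

text \<open>Freeness refers to the cycle and to no base point, so everything that commutes with the
  cycle respects it.\<close>

lemma free_equivariant:
  assumes "g \<in> gen_group S" shows "free (g ` A) = g ` free A"
proof -
  have "g x \<in> free (g ` A) \<longleftrightarrow> x \<in> free A" for x
    unfolding free_def using height_equivariant[OF assms] permutes_in_image[OF gen_perm[OF assms]]
    by auto
  then have "g -` free (g ` A) = free A" by auto
  then show ?thesis using permutes_surj[OF gen_perm[OF assms]] by (metis surj_image_vimage_eq)
qed

lemma orb_sym: "A \<simeq> B \<Longrightarrow> B \<simeq> A"
  using same_orbit_sym S_perm by blast

lemma orb_sub: "A \<simeq> B \<Longrightarrow> A \<subseteq> X \<Longrightarrow> B \<subseteq> X"
  unfolding same_orbit_def using gen_perm by (metis image_mono permutes_image)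

lemma orb_card: "A \<simeq> B \<Longrightarrow> card B = card A"
  unfolding same_orbit_def using gen_perm by (metis card_image inj_on_subset permutes_inj subset_UNIV)



section \<open>Existence and number of free points\<close>

lemma last_argmax:
  assumes "b \<in> X" "A \<subseteq> X" "2 * card A < m"
  obtains u where "u < m" "\<And>e. e \<le> m \<Longrightarrow> height A b e \<le> height A b u"
    "\<And>e. u < e \<Longrightarrow> e \<le> m \<Longrightarrow> height A b e < height A b u"
proof -
  define M where "M = Max (height A b ` {..m})"
  define U where "U = {e. e \<le> m \<and> height A b e = M}"
  have le: "height A b e \<le> M" if "e \<le> m" for e
    unfolding M_def using that by (intro Max_ge) auto
  have "M \<in> height A b ` {..m}" unfolding M_def by (intro Max_in) auto
  then have "finite U" "U \<noteq> {}" unfolding U_def by auto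
  then have U: "Max U \<in> U" "\<And>e. e \<in> U \<Longrightarrow> e \<le> Max U" by auto
  have "height A b m < 0" using height_period[OF assms(1,2)] assms(3) by simp
  moreover have "0 \<le> M" using le[of 0] by simp
  ultimately have "Max U \<noteq> m" using U(1) unfolding U_def by force
  show thesis
  proof (rule that)
    show "Max U < m" using U(1) \<open>Max U \<noteq> m\<close> unfolding U_def by simp
    show "height A b e \<le> height A b (Max U)" if "e \<le> m" for e
      using le[OF that] U(1) unfolding U_def by simp
    show "height A b e < height A b (Max U)" if "Max U < e" "e \<le> m" for e
      using le[OF that(2)] U that unfolding U_def by (metis (mono_tags, lifting) leD mem_Collect_eq nless_le)
  qed
qed

text \<open>Take the last maximum of the first period: later heights in the period are lower, and
  beyond it the negative drift keeps them lower. Earlier positions fail because the maximum still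
  lies ahead of them.\<close>

lemma first_free:
  assumes "b \<in> X" "A \<subseteq> X" "2 * card A < m"
  obtains u where "u < m" "(\<sigma> ^^ u) b \<in> free A" "\<And>p. (\<sigma> ^^ p) b \<in> free A \<Longrightarrow> u \<le> p"
    "\<And>e. e \<le> m \<Longrightarrow> height A b e \<le> height A b u"
    "\<And>e. u < e \<Longrightarrow> e \<le> m \<Longrightarrow> height A b e < height A b u"
proof -
  obtain u where u: "u < m" "\<And>e. e \<le> m \<Longrightarrow> height A b e \<le> height A b u"
    "\<And>e. u < e \<Longrightarrow> e \<le> m \<Longrightarrow> height A b e < height A b u"
    using last_argmax[OF assms] by metis
  have "height A b e < height A b u" if "u < e" for e
  proof (cases "e \<le> m")
    case False
    have "height A b e = int (e div m) * (2 * int (card A) - int m) + height A b (e mod m)"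
      using height_periods[OF assms(1,2), of "e div m" "e mod m"] by simp
    moreover have "int (e div m) * (2 * int (card A) - int m) < 0"
      using False assms(3) m_pos by (intro mult_pos_neg) (auto simp: div_greater_zero_iff)
    moreover have "height A b (e mod m) \<le> height A b u"
      using m_pos by (intro u(2)) (simp add: less_imp_le)
    ultimately show ?thesis by simp
  qed (use u(3) that in auto)
  then have "(\<sigma> ^^ u) b \<in> free A" unfolding free_pow_iff[OF assms(1)] by blast
  moreover have "u \<le> p" if "(\<sigma> ^^ p) b \<in> free A" for p
    using that u(1) u(2)[of p] unfolding free_pow_iff[OF assms(1)]
    by (metis linorder_not_le nat_le_linear order_le_less_trans order_less_le)
  ultimately show thesis using that u by blast
qed

text \<open>Seen from a free point \<open>i\<close>, free points are strict records of the height.\<close>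
lemma free_count:
  assumes "b \<in> X" "(\<sigma> ^^ i) b \<in> free A" "j \<le> i"
  shows "\<forall>e\<in>{j..i}. height A b e - height A b i \<le> int (card {p\<in>{j..<i}. (\<sigma> ^^ p) b \<in> free A})"
    and "\<exists>e\<in>{j..i}. height A b e - height A b i = int (card {p\<in>{j..<i}. (\<sigma> ^^ p) b \<in> free A})"
proof -
  let ?N = "\<lambda>j. int (card {p\<in>{j..<i}. (\<sigma> ^^ p) b \<in> free A})"
  let ?h = "height A b"
  \<comment> \<open>The number of free points is the largest excess over the height at
    \<open>i\<close>; bound and attainment go through one induction that moves \<open>j\<close> down
    from \<open>i\<close>.\<close>
  have "(\<forall>e\<in>{j..i}. ?h e - ?h i \<le> ?N j) \<and> (\<exists>e\<in>{j..i}. ?h e - ?h i = ?N j)"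
    using assms(3)
  proof (induction j rule: inc_induct)
    case base
    then show ?case by simp
  next
    case (step j)
    have iv: "{j..i} = insert j {Suc j..i}" using step(2) by auto
    show ?case
    proof (cases "(\<sigma> ^^ j) b \<in> free A")
      case True
      have "{p\<in>{j..<i}. (\<sigma> ^^ p) b \<in> free A} = insert j {p\<in>{Suc j..<i}. (\<sigma> ^^ p) b \<in> free A}"
        using step(2) True by (auto simp: order_le_less Suc_le_eq)
      then have N: "?N j = ?N (Suc j) + 1" by simp
      obtain e where e: "e \<in> {Suc j..i}" "?h e - ?h i = ?N (Suc j)" using step(3) by blast
      \<comment> \<open>A free \<open>j\<close> exceeds the former maximum, and by exactly one
        because a single step changes the height by one.\<close>
      have "?h e < ?h j" using True e(1) unfolding free_pow_iff[OF assms(1)] by auto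
      moreover have "?h j \<le> ?h (Suc j) + 1" by simp
      moreover have "?h (Suc j) - ?h i \<le> ?N (Suc j)"
        using step(2,3) by (simp del: height_Suc)
      ultimately have "?h j - ?h i = ?N j" using e N by linarith
      moreover have "\<forall>e\<in>{Suc j..i}. ?h e - ?h i \<le> ?N j" using step(3) N by fastforce
      ultimately show ?thesis unfolding iv by (simp del: height_Suc)
    next
      case False
      have "{p\<in>{j..<i}. (\<sigma> ^^ p) b \<in> free A} = {p\<in>{Suc j..<i}. (\<sigma> ^^ p) b \<in> free A}"
        using False by (auto simp: order_le_less Suc_le_eq)
      then have N: "?N j = ?N (Suc j)" by simp
      \<comment> \<open>If \<open>j\<close> is not free, some later position is at least as high;
        should it lie beyond \<open>i\<close>, then \<open>i\<close> is higher still. So the maximum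
        does not change.\<close>
      obtain d where d: "d > j" "?h j \<le> ?h d"
        using False unfolding free_pow_iff[OF assms(1)] by (auto simp: not_less)
      have "\<exists>e\<in>{Suc j..i}. ?h j \<le> ?h e"
      proof (cases "d \<le> i")
        case False
        then have "?h d < ?h i" using assms(2) unfolding free_pow_iff[OF assms(1)] by simp
        then show ?thesis using d step(2) by (intro bexI[of _ i]) auto
      qed (use d in auto)
      then have "?h j - ?h i \<le> ?N j" using step(3) N by fastforce
      then show ?thesis unfolding iv N[symmetric] using step(3) N by (simp del: height_Suc)
    qed
  qed
  then show "\<forall>e\<in>{j..i}. ?h e - ?h i \<le> ?N j" "\<exists>e\<in>{j..i}. ?h e - ?h i = ?N j" by auto
qed

text \<open>Walk once around from a free point. The largest excess over the final height occurs at
  the start, where it is minus the drift, and \<open>free_count\<close> identifies it with the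
  number of free points.\<close>

lemma card_free:
  assumes "A \<subseteq> X" "2 * card A \<le> m" shows "card (free A) = m - 2 * card A"
proof (cases "2 * card A = m")
  case True
  have "b \<notin> free A" if "b \<in> X" for b
    using height_period[OF that assms(1)] freeD[of b A m] True m_pos by auto
  then have "free A = {}" using free_sub by blast
  then show ?thesis using True by simp
next
  case False
  then have lt: "2 * card A < m" using assms by simp
  obtain b where b: "b \<in> X" "b \<in> free A"
    using first_free[OF _ assms(1) lt] nonempty free_sub by (metis ex_in_conv subsetD)
  \<comment> \<open>The end of the turn is the free point \<open>b\<close> again, so
    \<open>free_count\<close> applies with \<open>i = m\<close> and \<open>j = 0\<close>.\<close>
  have bm: "(\<sigma> ^^ m) b \<in> free A" using b pow_m by simp
  have "card {p\<in>{0..<m}. (\<sigma> ^^ p) b \<in> free A} = card (free A)"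
  proof (rule bij_betw_same_card)
    have "{p\<in>{0..<m}. (\<sigma> ^^ p) b \<in> free A} = {p\<in>{..<m}. (\<sigma> ^^ p) b \<in> free A}" by auto
    moreover have "inj_on (\<lambda>p. (\<sigma> ^^ p) b) {..<m}" "(\<lambda>p. (\<sigma> ^^ p) b) ` {..<m} = X"
      using cyc[OF b(1)] unfolding bij_betw_def by auto
    ultimately show "bij_betw (\<lambda>p. (\<sigma> ^^ p) b) {p\<in>{0..<m}. (\<sigma> ^^ p) b \<in> free A} (free A)"
      unfolding bij_betw_def using free_sub[of A] by (auto intro: inj_on_subset)
  qed
  moreover have m0: "height A b 0 - height A b m = int (m - 2 * card A)"
    using height_period[OF b(1) assms(1)] lt by simp
  moreover have "height A b e \<le> 0" for e
    using freeD[OF b(2), of e] by (cases "e = 0") auto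
  moreover have "height A b 0 - height A b m \<le> int (card {p\<in>{0..<m}. (\<sigma> ^^ p) b \<in> free A})"
    using free_count(1)[OF b(1) bm le0] by (meson atLeastAtMost_iff le0)
  moreover obtain e where "height A b e - height A b m = int (card {p\<in>{0..<m}. (\<sigma> ^^ p) b \<in> free A})"
    using free_count(2)[OF b(1) bm le0] by blast
  ultimately show ?thesis by (smt (verit, best) height_0 of_nat_eq_iff)
qed

section \<open>Reflection between complementary ranks\<close>

definition theta :: "nat set \<Rightarrow> nat set" where
  "theta A = A \<union> free A"

lemma theta_sub: "A \<subseteq> X \<Longrightarrow> theta A \<subseteq> X"
  unfolding theta_def using free_sub by auto

lemma card_theta:
  assumes "A \<subseteq> X" "2 * card A \<le> m" shows "card (theta A) = m - card A"
proof -
  have "finite A" "finite (free A)" using finite_subset finX assms(1) free_sub by blast+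
  then have "card (theta A) = card A + card (free A)"
    unfolding theta_def using free_disj by (intro card_Un_disjoint) auto
  then show ?thesis using card_free[OF assms] assms(2) by simp
qed

text \<open>Each free point passed turns a step down into a step up.\<close>

lemma height_theta:
  "height (theta A) b n = height A b n + 2 * int (card {p\<in>{..<n}. (\<sigma> ^^ p) b \<in> free A})"
proof (induction n)
  case (Suc n)
  have "{p\<in>{..<Suc n}. (\<sigma> ^^ p) b \<in> free A} =
      (if (\<sigma> ^^ n) b \<in> free A then insert n else id) {p\<in>{..<n}. (\<sigma> ^^ p) b \<in> free A}"
    by (auto simp: less_Suc_eq)
  then have "int (card {p\<in>{..<Suc n}. (\<sigma> ^^ p) b \<in> free A}) =
      (if (\<sigma> ^^ n) b \<in> free A then 1 else 0) + int (card {p\<in>{..<n}. (\<sigma> ^^ p) b \<in> free A})"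
    by simp
  moreover have "(\<sigma> ^^ n) b \<in> theta A \<longleftrightarrow> (\<sigma> ^^ n) b \<in> A \<or> (\<sigma> ^^ n) b \<in> free A"
    by (simp add: theta_def)
  moreover have "\<not> ((\<sigma> ^^ n) b \<in> A \<and> (\<sigma> ^^ n) b \<in> free A)"
    using free_disj by blast
  ultimately show ?case using Suc unfolding height_Suc by (simp split: if_splits)
qed simp

lemma card_free_split:
  assumes "j \<le> i"
  shows "card {p\<in>{..<i}. (\<sigma> ^^ p) b \<in> free A} =
    card {p\<in>{..<j}. (\<sigma> ^^ p) b \<in> free A} + card {p\<in>{j..<i}. (\<sigma> ^^ p) b \<in> free A}"
proof -
  have "{p\<in>{..<i}. (\<sigma> ^^ p) b \<in> free A} =
      {p\<in>{..<j}. (\<sigma> ^^ p) b \<in> free A} \<union> {p\<in>{j..<i}. (\<sigma> ^^ p) b \<in> free A}"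
    using assms by auto
  moreover have "{p\<in>{..<j}. (\<sigma> ^^ p) b \<in> free A} \<inter> {p\<in>{j..<i}. (\<sigma> ^^ p) b \<in> free A} = {}"
    by auto
  ultimately show ?thesis
    by (metis (no_types, lifting) card_Un_disjoint finite_atLeastLessThan finite_lessThan finite_subset
        mem_Collect_eq subsetI)
qed

text \<open>The free points of \<open>A\<close> are recovered from \<open>theta A\<close> as the strict record
  maxima of its height.\<close>
lemma theta_record:
  assumes "b \<in> X" "(\<sigma> ^^ p) b \<in> free A" "e \<le> p"
  shows "height (theta A) b e < height (theta A) b (Suc p)"
proof -
  let ?N = "int (card {q\<in>{e..<p}. (\<sigma> ^^ q) b \<in> free A})"
  have "height A b e - height A b p \<le> ?N"
    using free_count(1)[OF assms] assms(3) by auto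
  moreover have "(\<sigma> ^^ p) b \<in> theta A" using assms(2) by (simp add: theta_def)
  ultimately show ?thesis
    using height_theta[of A b e] height_theta[of A b p] card_free_split[OF assms(3), of b A] by simp
qed

text \<open>No point after \<open>u\<close> up to \<open>p\<close> is free, so \<open>theta\<close>
  raises both heights equally. In the walk of \<open>A\<close> everything after \<open>u\<close> is
  lower than at \<open>u\<close>, and the step at \<open>u\<close> loses only one.\<close>

lemma theta_no_record:
  assumes "b \<in> X" "(\<sigma> ^^ u) b \<in> free A" "u < p" "\<And>q. u < q \<Longrightarrow> q \<le> p \<Longrightarrow> (\<sigma> ^^ q) b \<notin> free A"
  shows "height (theta A) b (Suc p) \<le> height (theta A) b (Suc u)"
proof -
  have "{q\<in>{Suc u..<Suc p}. (\<sigma> ^^ q) b \<in> free A} = {}" using assms(4) by auto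
  then have "card {q\<in>{Suc u..<Suc p}. (\<sigma> ^^ q) b \<in> free A} = 0" by (simp only: card.empty)
  moreover have "height A b (Suc p) < height A b u"
    using assms(2,3) unfolding free_pow_iff[OF assms(1)] by (simp del: height_Suc)
  moreover have "height A b u \<le> height A b (Suc u) + 1" by simp
  ultimately show ?thesis
    using height_theta[of A b "Suc u"] height_theta[of A b "Suc p"]
      card_free_split[of "Suc u" "Suc p" b A] assms(3) by linarith
qed

text \<open>Starting at a free point of \<open>B\<close>, look at the last \<open>B\<close>-free
  position before a supposed counterexample \<open>x\<close>: judged by \<open>A\<close>, the walk
  of the common image rises to a new record at \<open>x\<close>; judged by \<open>B\<close>, it does
  not.\<close>

lemma free_le_of_theta_eq:
  assumes "theta A = theta B" "A \<subseteq> X" "B \<subseteq> X" "card A = card B"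
  shows "free A \<subseteq> free B"
proof
  fix x assume x: "x \<in> free A"
  show "x \<in> free B"
  proof (rule ccontr)
    assume nx: "x \<notin> free B"
    have "x \<in> X" using x free_sub by auto
    have "2 * card A < m"
      using freeD[OF x m_pos] height_period[OF \<open>x \<in> X\<close> assms(2)] by simp
    then have "2 * card B < m" using assms(4) by simp
    then obtain b where b: "b \<in> X" "b \<in> free B"
      using first_free[OF _ assms(3)] nonempty free_sub by (metis ex_in_conv subsetD)
    obtain p where p: "x = (\<sigma> ^^ p) b" using reach[OF b(1) \<open>x \<in> X\<close>] by metis
    define U where "U = {q. q < p \<and> (\<sigma> ^^ q) b \<in> free B}"
    have "p \<noteq> 0" using nx p b by (metis funpow_0)
    then have "0 \<in> U" "finite U" unfolding U_def using b by auto
    then have u: "Max U \<in> U" "\<And>q. q \<in> U \<Longrightarrow> q \<le> Max U" by (auto intro: Max_in)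
    have "height (theta B) b (Suc p) \<le> height (theta B) b (Suc (Max U))"
    proof (rule theta_no_record[OF b(1)])
      show "(\<sigma> ^^ Max U) b \<in> free B" "Max U < p" using u(1) by (auto simp: U_def)
      show "(\<sigma> ^^ q) b \<notin> free B" if "Max U < q" "q \<le> p" for q
      proof
        assume q: "(\<sigma> ^^ q) b \<in> free B"
        then have "q \<noteq> p" using nx p by auto
        then have "q \<in> U" using q that by (simp add: U_def)
        then show False using u(2) that by fastforce
      qed
    qed
    moreover have "height (theta A) b (Suc (Max U)) < height (theta A) b (Suc p)"
      using theta_record[OF b(1), of p A "Suc (Max U)"] x p u(1) by (simp add: U_def)
    ultimately show False using assms(1) by simp
  qed
qed

lemma theta_inj:
  assumes "theta A = theta B" "A \<subseteq> X" "B \<subseteq> X" "card A = card B"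
  shows "A = B"
proof -
  have "free A = free B"
    using free_le_of_theta_eq[OF assms]
      free_le_of_theta_eq[OF assms(1)[symmetric] assms(3,2) assms(4)[symmetric]]
    by auto
  moreover have "A = theta A - free A" "B = theta B - free B"
    unfolding theta_def using free_disj by auto
  ultimately show ?thesis using assms(1) by metis
qed

text \<open>Injectivity is enough, since complementary ranks contain equally many subsets.\<close>

lemma theta_surj:
  assumes "B \<subseteq> X" "m \<le> 2 * card B"
  obtains A where "A \<subseteq> X" "theta A = B" "card A = m - card B"
proof -
  let ?k = "m - card B"
  have cB: "card B \<le> m" using card_mono[OF finX assms(1)] .
  have inj: "inj_on theta {A. A \<subseteq> X \<and> card A = ?k}"
    using theta_inj by (intro inj_onI) auto
  have "theta ` {A. A \<subseteq> X \<and> card A = ?k} = {A. A \<subseteq> X \<and> card A = card B}"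
  proof (rule card_subset_eq)
    show "finite {A. A \<subseteq> X \<and> card A = card B}" using finX by simp
    show "theta ` {A. A \<subseteq> X \<and> card A = ?k} \<subseteq> {A. A \<subseteq> X \<and> card A = card B}"
      using theta_sub card_theta assms(2) cB by auto
    show "card (theta ` {A. A \<subseteq> X \<and> card A = ?k}) = card {A. A \<subseteq> X \<and> card A = card B}"
      using card_image[OF inj] n_subsets[OF finX] binomial_symmetric[OF cB] by simp
  qed
  then have "B \<in> theta ` {A. A \<subseteq> X \<and> card A = ?k}" using assms(1) by simp
  then show thesis using that by blast
qed

lemma theta_equivariant:
  assumes "A \<simeq> B" shows "theta A \<simeq> theta B"
proof -
  obtain g where g: "g \<in> gen_group S" "B = g ` A" using assms unfolding same_orbit_def by auto
  then have "theta B = g ` theta A" unfolding theta_def by (simp add: image_Un free_equivariant)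
  then show ?thesis using g unfolding same_orbit_def by blast
qed

text \<open>Equivariance moves \<open>A\<close> inside its orbit until the two images coincide;
  injectivity on sets then applies.\<close>

lemma theta_orb:
  assumes "theta A \<simeq> theta B" "A \<subseteq> X" "B \<subseteq> X" "card A = card B"
  shows "A \<simeq> B"
proof -
  obtain g where g: "g \<in> gen_group S" "theta B = g ` theta A"
    using assms(1) unfolding same_orbit_def by auto
  have o: "A \<simeq> g ` A" using g unfolding same_orbit_def by blast
  have "theta (g ` A) = g ` theta A"
    unfolding theta_def by (simp add: image_Un free_equivariant[OF g(1)])
  then have "theta (g ` A) = theta B" using g(2) by simp
  then have "g ` A = B" using theta_inj assms orb_sub[OF o] orb_card[OF o] by simp
  then show ?thesis using o by simp
qed

section \<open>Injecting orbits into the next rank\<close>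

definition base :: nat where
  "base = (SOME b. b \<in> X)"

lemma base_in: "base \<in> X"
  unfolding base_def using nonempty by (simp add: some_in_eq)

definition pos :: "nat \<Rightarrow> nat" where
  "pos x = (LEAST p. (\<sigma> ^^ p) base = x)"

lemma pos_pow: assumes "p < m" shows "pos ((\<sigma> ^^ p) base) = p"
  unfolding pos_def
proof (rule Least_equality)
  fix q assume q: "(\<sigma> ^^ q) base = (\<sigma> ^^ p) base"
  show "p \<le> q"
  proof (rule ccontr)
    assume "\<not> p \<le> q"
    then show False
      using inj_onD[OF bij_betw_imp_inj_on[OF cyc[OF base_in]] q] assms by auto
  qed
qed simp

lemma pow_pos: assumes "x \<in> X" shows "pos x < m" "(\<sigma> ^^ pos x) base = x"
  using reach[OF base_in assms] pos_pow by metis+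

text \<open>A binary number in which earlier positions carry larger powers of two, so that comparing
  weights is comparing the opened words lexicographically.\<close>

definition weight :: "nat set \<Rightarrow> nat" where
  "weight A = set_encode ((\<lambda>x. m - pos x) ` A)"

lemma weight_pos_inj: "inj_on (\<lambda>x. m - pos x) X"
proof (rule inj_onI)
  fix x y assume xy: "x \<in> X" "y \<in> X" "m - pos x = m - pos y"
  then have "pos x = pos y" using pow_pos[OF xy(1)] pow_pos[OF xy(2)] by simp
  then show "x = y" using pow_pos xy by metis
qed

lemma weight_inj:
  assumes "weight A = weight B" "A \<subseteq> X" "B \<subseteq> X" shows "A = B"
proof -
  have "finite ((\<lambda>x. m - pos x) ` A)" "finite ((\<lambda>x. m - pos x) ` B)"
    using assms finite_subset finX by blast+
  then have "(\<lambda>x. m - pos x) ` A = (\<lambda>x. m - pos x) ` B"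
    using assms(1) unfolding weight_def by (simp add: set_encode_eq)
  then show ?thesis using weight_pos_inj assms(2,3) by (simp add: inj_on_image_eq_iff)
qed

lemma weight_insert:
  assumes "x \<in> X" "A \<subseteq> X" "x \<notin> A"
  shows "weight (insert x A) = 2 ^ (m - pos x) + weight A"
proof -
  have "m - pos x \<notin> (\<lambda>x. m - pos x) ` A"
    using weight_pos_inj assms by (auto dest: inj_onD)
  moreover have "finite ((\<lambda>x. m - pos x) ` A)" using assms finite_subset finX by blast
  ultimately show ?thesis unfolding weight_def by (simp add: set_encode_insert)
qed

section \<open>The Greene-Kleitman map on the opened cycle\<close>

definition extend :: "nat set \<Rightarrow> nat set" where
  "extend A = insert ((\<sigma> ^^ (LEAST p. (\<sigma> ^^ p) base \<in> free A)) base) A"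

lemma extend_obtain:
  assumes "A \<subseteq> X" "2 * card A < m"
  obtains u where "u < m" "extend A = insert ((\<sigma> ^^ u) base) A" "(\<sigma> ^^ u) base \<in> free A"
    "\<And>p. (\<sigma> ^^ p) base \<in> free A \<Longrightarrow> u \<le> p"
    "\<And>e. e \<le> m \<Longrightarrow> height A base e \<le> height A base u"
    "\<And>e. u < e \<Longrightarrow> e \<le> m \<Longrightarrow> height A base e < height A base u"
proof -
  obtain u where u: "u < m" "(\<sigma> ^^ u) base \<in> free A"
    "\<And>p. (\<sigma> ^^ p) base \<in> free A \<Longrightarrow> u \<le> p"
    "\<And>e. e \<le> m \<Longrightarrow> height A base e \<le> height A base u"
    "\<And>e. u < e \<Longrightarrow> e \<le> m \<Longrightarrow> height A base e < height A base u"
    using first_free[OF base_in assms] by metis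
  have "(LEAST p. (\<sigma> ^^ p) base \<in> free A) = u"
    using u(2,3) by (intro Least_equality) auto
  then show thesis using that[OF u(1) _ u(2-)] unfolding extend_def by simp
qed

lemma height_insert:
  assumes "u < m" "(\<sigma> ^^ u) base \<notin> A" "e \<le> m"
  shows "height (insert ((\<sigma> ^^ u) base) A) base e = height A base e + (if u < e then 2 else 0)"
  using assms(3)
proof (induction e)
  case (Suc e)
  have "(\<sigma> ^^ e) base = (\<sigma> ^^ u) base \<longleftrightarrow> e = u"
    using inj_onD[OF bij_betw_imp_inj_on[OF cyc[OF base_in]], of e u] Suc assms(1) by auto
  then show ?case using Suc assms(2) by auto
qed simp

text \<open>Raising the part after the last maximum by two makes \<open>Suc u\<close> the first
  maximum of the new walk over one turn, so the inserted point can be read off from the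
  result.\<close>

lemma extend_less_record:
  assumes "A \<subseteq> X" "2 * card A < m" "extend A = insert ((\<sigma> ^^ u) base) A" "u < m"
    "(\<sigma> ^^ u) base \<in> free A"
    "\<And>e. e \<le> m \<Longrightarrow> height A base e \<le> height A base u"
    "\<And>e. u < e \<Longrightarrow> e \<le> m \<Longrightarrow> height A base e < height A base u" "e \<le> m"
  shows "height (extend A) base e \<le> height (extend A) base (Suc u)"
    and "e \<le> u \<Longrightarrow> height (extend A) base e < height (extend A) base (Suc u)"
proof -
  have nA: "(\<sigma> ^^ u) base \<notin> A" using assms(5) free_disj by auto
  have h: "height (extend A) base e = height A base e + (if u < e then 2 else 0)" if "e \<le> m" for e
    using height_insert[OF assms(4) nA that] assms(3) by simp
  have middle: "height (extend A) base (Suc u) = height A base u + 1"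
    using h[of "Suc u"] assms(4) nA by simp
  show "height (extend A) base e \<le> height (extend A) base (Suc u)"
    using h[OF assms(8)] assms(6)[OF assms(8)] assms(7)[OF _ assms(8)] middle by (cases "u < e") auto
  show "height (extend A) base e < height (extend A) base (Suc u)" if "e \<le> u"
    using h[OF assms(8)] assms(6)[OF assms(8)] middle that by simp
qed

lemma extend_inj:
  assumes "extend A = extend B" "A \<subseteq> X" "B \<subseteq> X" "2 * card A < m" "2 * card B < m"
  shows "A = B"
proof -
  obtain u where u: "u < m" "extend A = insert ((\<sigma> ^^ u) base) A" "(\<sigma> ^^ u) base \<in> free A"
    "\<And>e. e \<le> m \<Longrightarrow> height A base e \<le> height A base u"
    "\<And>e. u < e \<Longrightarrow> e \<le> m \<Longrightarrow> height A base e < height A base u"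
    using extend_obtain[OF assms(2,4)] by metis
  obtain v where v: "v < m" "extend B = insert ((\<sigma> ^^ v) base) B" "(\<sigma> ^^ v) base \<in> free B"
    "\<And>e. e \<le> m \<Longrightarrow> height B base e \<le> height B base v"
    "\<And>e. v < e \<Longrightarrow> e \<le> m \<Longrightarrow> height B base e < height B base v"
    using extend_obtain[OF assms(3,5)] by metis
  note U = extend_less_record[OF assms(2,4) u(2,1,3-5)]
  note V = extend_less_record[OF assms(3,5) v(2,1,3-5)]
  \<comment> \<open>\<open>Suc u\<close> and \<open>Suc v\<close> are both the first maximum of the
    same walk.\<close>
  have "\<not> u < v"
    using U(1)[of "Suc v"] V(2)[of "Suc u"] u(1) v(1) assms(1) by fastforce
  moreover have "\<not> v < u"
    using V(1)[of "Suc u"] U(2)[of "Suc v"] u(1) v(1) assms(1) by fastforce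
  ultimately have "u = v" by simp
  moreover have "A = extend A - {(\<sigma> ^^ u) base}" "B = extend B - {(\<sigma> ^^ v) base}"
    using u(2,3) v(2,3) free_disj by auto
  ultimately show ?thesis using assms(1) by metis
qed

text \<open>All candidates add one power of two to the same weight, and the first free position
  carries the largest.\<close>

lemma weight_extend:
  assumes "A \<subseteq> X" "2 * card A < m" "x \<in> free A"
  shows "weight (insert x A) \<le> weight (extend A)"
proof -
  obtain u where u: "u < m" "extend A = insert ((\<sigma> ^^ u) base) A" "(\<sigma> ^^ u) base \<in> free A"
    "\<And>p. (\<sigma> ^^ p) base \<in> free A \<Longrightarrow> u \<le> p"
    using extend_obtain[OF assms(1,2)] by metis
  have "x \<in> X" "(\<sigma> ^^ u) base \<in> X" using assms(3) u(3) free_sub by auto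
  moreover have "x \<notin> A" "(\<sigma> ^^ u) base \<notin> A" using assms(3) u(3) free_disj by auto
  moreover have "u \<le> pos x" using u(4) pow_pos(2)[OF \<open>x \<in> X\<close>] assms(3) by simp
  ultimately show ?thesis
    using weight_insert[OF _ assms(1)] u(2) pos_pow[OF u(1)] by (simp add: diff_le_mono2)
qed

section \<open>Numerical codes of orbits\<close>

lemma finite_orb: "A \<subseteq> X \<Longrightarrow> finite {B. A \<simeq> B}"
proof (rule finite_subset)
  show "A \<subseteq> X \<Longrightarrow> {B. A \<simeq> B} \<subseteq> Pow X" using orb_sub by blast
qed (simp add: finX)

lemma orb_class: "A \<simeq> B \<Longrightarrow> {C. A \<simeq> C} = {C. B \<simeq> C}"
  using orb_sym same_orbit_trans by blast

text \<open>Weights determine sets, so the greatest weight in an orbit determines one of its members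
  and hence the orbit.\<close>

definition orbit_code :: "nat set \<Rightarrow> nat" where
  "orbit_code A = Max (weight ` {B. A \<simeq> B})"

lemma orbit_code_iff:
  assumes "A \<subseteq> X" "B \<subseteq> X" shows "orbit_code A = orbit_code B \<longleftrightarrow> A \<simeq> B"
proof
  assume eq: "orbit_code A = orbit_code B"
  have "\<exists>Y. Z \<simeq> Y \<and> orbit_code Z = weight Y" if "Z \<subseteq> X" for Z
    using Max_in[of "weight ` {B. Z \<simeq> B}"] finite_orb[OF that] same_orbit_refl[of S Z]
    unfolding orbit_code_def by fastforce
  then obtain Y Z where YZ: "A \<simeq> Y" "B \<simeq> Z" "weight Y = weight Z" using assms eq by metis
  then have "Y = Z" using weight_inj orb_sub assms by metis
  then show "A \<simeq> B" using YZ orb_sym same_orbit_trans by metis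
next
  assume "A \<simeq> B"
  then show "orbit_code A = orbit_code B" unfolding orbit_code_def using orb_class by simp
qed

definition best :: "nat set \<Rightarrow> nat set \<Rightarrow> bool" where
  "best A Y \<longleftrightarrow> A \<simeq> Y \<and> (\<forall>Z. A \<simeq> Z \<longrightarrow> weight (extend Z) \<le> weight (extend Y))"

definition Phi :: "nat set \<Rightarrow> nat set" where
  "Phi A = extend (SOME Y. best A Y)"

lemma best_ex: assumes "A \<subseteq> X" shows "\<exists>Y. best A Y"
proof -
  let ?W = "(\<lambda>Z. weight (extend Z)) ` {Z. A \<simeq> Z}"
  have fin: "finite ?W" using finite_orb[OF assms] by simp
  have "?W \<noteq> {}" using same_orbit_refl by blast
  then have "Max ?W \<in> ?W" using fin by simp
  then obtain Y where "A \<simeq> Y" "weight (extend Y) = Max ?W" by auto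
  then show ?thesis unfolding best_def using Max_ge[OF fin] by (intro exI[of _ Y]) simp
qed

lemma Phi_obtain:
  assumes "A \<subseteq> X" obtains Y where "best A Y" "Phi A = extend Y"
  unfolding Phi_def using someI_ex[OF best_ex[OF assms]] by blast

text \<open>\<open>best A\<close> depends on the orbit only, and the choice operator is applied to
  that predicate; hence equality of sets rather than mere equivalence.\<close>

lemma Phi_cong: assumes "A \<simeq> B" shows "Phi A = Phi B"
proof -
  have "best A = best B"
    unfolding best_def using orb_class[OF assms] by (auto simp: fun_eq_iff set_eq_iff)
  then show ?thesis by (simp add: Phi_def)
qed

lemma Phi_above:
  assumes "A \<subseteq> X" "2 * card A < m"
  obtains Y x where "A \<simeq> Y" "Y \<subseteq> X" "x \<in> free Y" "Phi A = insert x Y"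
proof -
  obtain Y where Y: "best A Y" "Phi A = extend Y" using Phi_obtain[OF assms(1)] by metis
  have AY: "A \<simeq> Y" "Y \<subseteq> X" "2 * card Y < m"
    using Y orb_sub orb_card assms unfolding best_def by auto
  then show thesis using that extend_obtain[OF AY(2,3)] Y(2) by metis
qed

lemma Phi_sub_card:
  assumes "A \<subseteq> X" "2 * card A < m" shows "Phi A \<subseteq> X" "card (Phi A) = Suc (card A)"
proof -
  obtain Y x where Y: "A \<simeq> Y" "Y \<subseteq> X" "x \<in> free Y" "Phi A = insert x Y"
    using Phi_above[OF assms] by metis
  have "x \<notin> Y" "x \<in> X" using Y(3) free_disj free_sub by blast+
  then show "Phi A \<subseteq> X" "card (Phi A) = Suc (card A)"
    using Y orb_card[OF Y(1)] finite_subset[OF Y(2) finX] by auto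
qed

text \<open>Moving to the free point of smallest position maximises the weight among all insertions of a
  free point, so \<open>Phi A\<close> is the heaviest member of its own orbit.\<close>
lemma Phi_heaviest:
  assumes "A \<subseteq> X" "2 * card A < m" "Phi A \<simeq> Z"
  shows "weight Z \<le> weight (Phi A)"
proof -
  obtain Y where Y: "best A Y" "Phi A = extend Y" using Phi_obtain[OF assms(1)] by metis
  have AY: "A \<simeq> Y" "Y \<subseteq> X" "2 * card Y < m"
    using Y orb_sub orb_card assms unfolding best_def by auto
  obtain x where x: "x \<in> free Y" "extend Y = insert x Y" using extend_obtain[OF AY(2,3)] by metis
  obtain g where g: "g \<in> gen_group S" "Z = g ` Phi A" using assms(3) unfolding same_orbit_def by auto
  have o: "A \<simeq> g ` Y" using AY(1) g(1) same_orbit_trans unfolding same_orbit_def by metis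
  \<comment> \<open>\<open>Z\<close> is itself a free-point insertion into a member of the orbit of
    \<open>A\<close>, and so is bounded by the maximum in \<open>best\<close>.\<close>
  have "Z = insert (g x) (g ` Y)" using g(2) Y(2) x(2) by simp
  moreover have "g x \<in> free (g ` Y)" using free_equivariant[OF g(1)] x(1) by simp
  ultimately have "weight Z \<le> weight (extend (g ` Y))"
    using weight_extend[of "g ` Y" "g x"] orb_sub[OF o] orb_card[OF o] assms by simp
  also have "\<dots> \<le> weight (Phi A)" using Y o unfolding best_def by simp
  finally show ?thesis .
qed

text \<open>Both images are heaviest in their common orbit and hence equal as sets, which reduces
  the claim to \<open>extend_inj\<close>.\<close>

lemma Phi_inj:
  assumes "Phi A \<simeq> Phi B" "A \<subseteq> X" "B \<subseteq> X" "2 * card A < m" "2 * card B < m"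
  shows "A \<simeq> B"
proof -
  have "weight (Phi A) = weight (Phi B)"
    using Phi_heaviest[OF assms(2,4,1)] Phi_heaviest[OF assms(3,5) orb_sym[OF assms(1)]] by simp
  then have eq: "Phi A = Phi B" using weight_inj Phi_sub_card assms by metis
  obtain Y where Y: "best A Y" "Phi A = extend Y" using Phi_obtain[OF assms(2)] by metis
  obtain Z where Z: "best B Z" "Phi B = extend Z" using Phi_obtain[OF assms(3)] by metis
  have AY: "A \<simeq> Y" "B \<simeq> Z" using Y Z unfolding best_def by auto
  have "Y = Z"
    using extend_inj[of Y Z] eq Y(2) Z(2) orb_sub[OF AY(1)] orb_sub[OF AY(2)]
      orb_card[OF AY(1)] orb_card[OF AY(2)] assms by simp
  then show ?thesis using AY orb_sym same_orbit_trans by metis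
qed

text \<open>Climbing to rank \<open>m div 2\<close> names a chain by the orbit in which it meets
  that rank. Truncated subtraction leaves sets of larger rank unchanged.\<close>

definition middle :: "nat set \<Rightarrow> nat set" where
  "middle A = (Phi ^^ (m div 2 - card A)) A"

lemma middle_Phi:
  assumes "A \<subseteq> X" "card A < m div 2" shows "middle (Phi A) = middle A"
proof -
  have "m div 2 - card A = Suc (m div 2 - Suc (card A))" using assms(2) by simp
  then show ?thesis
    using Phi_sub_card(2)[of A] assms unfolding middle_def by (simp add: funpow_swap1)
qed

lemma middle_sub: "A \<subseteq> X \<Longrightarrow> middle A \<subseteq> X"
proof (induction "m div 2 - card A" arbitrary: A)
  case (Suc n)
  then have "2 * card A < m" "card A < m div 2" by auto
  moreover have "n = m div 2 - card (Phi A)" using Suc calculation Phi_sub_card[of A] by simp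
  ultimately show ?case using Suc(1)[of "Phi A"] Suc(3) middle_Phi[of A] Phi_sub_card[of A] by simp
qed (simp add: middle_def)

lemma middle_cong:
  assumes "A \<simeq> B" shows "middle A \<simeq> middle B"
proof (cases "m div 2 - card A")
  case (Suc n)
  then show ?thesis
    using Phi_cong[OF assms] orb_card[OF assms] same_orbit_refl
    unfolding middle_def by (simp add: funpow_Suc_right del: funpow.simps)
qed (use assms orb_card[OF assms] in \<open>simp add: middle_def\<close>)

text \<open>Equal cardinalities make both climbs equally long, so \<open>Phi_inj\<close> can be
  peeled off step by step.\<close>

lemma middle_inj:
  assumes "middle A \<simeq> middle B" "A \<subseteq> X" "B \<subseteq> X" "card A = card B"
  shows "A \<simeq> B"
  using assms
proof (induction "m div 2 - card A" arbitrary: A B)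
  case (Suc n)
  then have lt: "2 * card A < m" "card A < m div 2" "2 * card B < m" "card B < m div 2" by auto
  have "Phi A \<simeq> Phi B"
  proof (rule Suc(1))
    show "n = m div 2 - card (Phi A)" using Suc(2) Phi_sub_card(2)[OF Suc(4) lt(1)] by simp
    show "middle (Phi A) \<simeq> middle (Phi B)"
      using Suc(3) middle_Phi[OF Suc(4) lt(2)] middle_Phi[OF Suc(5) lt(4)] by simp
    show "Phi A \<subseteq> X" "Phi B \<subseteq> X" "card (Phi A) = card (Phi B)"
      using Phi_sub_card[OF Suc(4) lt(1)] Phi_sub_card[OF Suc(5) lt(3)] Suc(6) by simp_all
  qed
  then show ?case using Phi_inj lt Suc(4,5) by metis
qed (simp add: middle_def)

text \<open>\<open>lower\<close> folds the upper half of the ranks onto the lower half, inverting \<open>theta\<close>.\<close>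
definition lower :: "nat set \<Rightarrow> nat set" where
  "lower B = (if 2 * card B \<le> m then B else SOME A. A \<subseteq> X \<and> theta A = B \<and> card A = m - card B)"

text \<open>No point is free in the middle rank, so \<open>lower\<close> inverts
  \<open>theta\<close> there too, although it takes its identity branch.\<close>

lemma theta_half: "A \<subseteq> X \<Longrightarrow> 2 * card A = m \<Longrightarrow> theta A = A"
  using card_free[of A] free_sub[of A] finite_subset[OF _ finX] unfolding theta_def by auto

lemma lower_low: "2 * card B \<le> m \<Longrightarrow> lower B = B"
  by (simp add: lower_def)

lemma lower_sub: "B \<subseteq> X \<Longrightarrow> lower B \<subseteq> X"
  and lower_theta: "B \<subseteq> X \<Longrightarrow> m \<le> 2 * card B \<Longrightarrow> theta (lower B) = B"
  and lower_card: "B \<subseteq> X \<Longrightarrow> m \<le> 2 * card B \<Longrightarrow> card (lower B) = m - card B"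
proof -
  have *: "lower B \<subseteq> X \<and> theta (lower B) = B \<and> card (lower B) = m - card B"
    if B: "B \<subseteq> X" "2 * card B > m" for B
  proof -
    have "\<exists>A. A \<subseteq> X \<and> theta A = B \<and> card A = m - card B"
      using theta_surj[OF B(1)] B(2) by (metis less_imp_le)
    from someI_ex[OF this] show ?thesis using B(2) unfolding lower_def by simp
  qed
  show "B \<subseteq> X \<Longrightarrow> lower B \<subseteq> X" using *[of B] lower_low[of B] by (cases "2 * card B > m") auto
  show "B \<subseteq> X \<Longrightarrow> m \<le> 2 * card B \<Longrightarrow> theta (lower B) = B"
    using *[of B] lower_low[of B] theta_half[of B] by (cases "2 * card B > m") auto
  show "B \<subseteq> X \<Longrightarrow> m \<le> 2 * card B \<Longrightarrow> card (lower B) = m - card B"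
    using *[of B] lower_low[of B] by (cases "2 * card B > m") auto
qed

lemma lower_cong:
  assumes "A \<simeq> B" "A \<subseteq> X" shows "lower A \<simeq> lower B"
proof (cases "2 * card A \<le> m")
  case True
  then show ?thesis using assms orb_card[OF assms(1)] lower_low by simp
next
  case False
  have B: "B \<subseteq> X" "card B = card A" using orb_sub orb_card assms by auto
  show ?thesis
    using theta_orb[of "lower A" "lower B"] assms False B lower_theta lower_sub lower_card by simp
qed

lemma lower_orb:
  assumes "lower A \<simeq> lower B" "A \<subseteq> X" "B \<subseteq> X" "card A = card B" shows "A \<simeq> B"
proof (cases "2 * card A \<le> m")
  case True
  then show ?thesis using assms lower_low by simp
next
  case False
  then show ?thesis
    using theta_equivariant[OF assms(1)] assms lower_theta by simp
qed

definition chain_id :: "nat set \<Rightarrow> nat" where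
  "chain_id A = orbit_code (middle (lower A))"

lemma chain_id_iff:
  assumes "A \<subseteq> X" "B \<subseteq> X" shows "chain_id A = chain_id B \<longleftrightarrow> middle (lower A) \<simeq> middle (lower B)"
  unfolding chain_id_def using orbit_code_iff middle_sub lower_sub assms by simp

lemma chain_id_cong: "A \<simeq> B \<Longrightarrow> A \<subseteq> X \<Longrightarrow> chain_id A = chain_id B"
  using chain_id_iff[of A B] orb_sub[of A B] middle_cong[OF lower_cong[of A B]] by simp

lemma card_lower:
  assumes "A \<subseteq> X" shows "card (lower A) = min (card A) (m - card A)"
  using lower_card[OF assms] lower_low[of A] by (cases "2 * card A \<le> m") auto

lemma chain_id_lower:
  assumes "chain_id A = chain_id B" "A \<subseteq> X" "B \<subseteq> X" "card (lower A) = card (lower B)"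
  shows "lower A \<simeq> lower B"
  using middle_inj[OF _ lower_sub[OF assms(2)] lower_sub[OF assms(3)] assms(4)] assms(1)
    chain_id_iff[OF assms(2,3)] by simp

lemma chain_id_orb:
  assumes "chain_id A = chain_id B" "A \<subseteq> X" "B \<subseteq> X" "card A = card B" shows "A \<simeq> B"
  using lower_orb[OF chain_id_lower[OF assms(1-3)] assms(2-)] card_lower assms(2-) by simp

lemma lift_sub:
  assumes "Z \<simeq> A" "Z \<subseteq> W" obtains W' where "W \<simeq> W'" "A \<subseteq> W'"
  using assms unfolding same_orbit_def by (metis image_mono)

lemma Phi_chain:
  assumes "middle A \<simeq> middle B" "A \<subseteq> X" "B \<subseteq> X" "card B = Suc (card A)" "2 * card B \<le> m"
  obtains x Z where "A \<simeq> Z" "Z \<subseteq> X" "x \<in> free Z" "B \<simeq> insert x Z"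
proof -
  have lt: "card A < m div 2" "2 * card A < m" using assms by auto
  have "middle (Phi A) \<simeq> middle B" using middle_Phi[OF assms(2) lt(1)] assms(1) by simp
  then have "Phi A \<simeq> B" using middle_inj Phi_sub_card[OF assms(2) lt(2)] assms by simp
  then show thesis using Phi_above[OF assms(2) lt(2)] that orb_sym by metis
qed

lemma chain_id_step:
  assumes "chain_id A = chain_id B" "A \<subseteq> X" "B \<subseteq> X" "card B = Suc (card A)"
  obtains B' where "B \<simeq> B'" "A \<subseteq> B'"
proof -
  have cB: "card B \<le> m" using card_mono[OF finX assms(3)] .
  have t: "middle (lower A) \<simeq> middle (lower B)" using assms chain_id_iff by simp
  \<comment> \<open>The ranks lie both in the lower half, both in the upper half, or are the two
    middle ranks of an odd cycle.\<close>
  consider "2 * card B \<le> m" | "m \<le> 2 * card A" | "m = 2 * card A + 1" using assms(4) by linarith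
  then show thesis
  proof cases
    case 1
    have "middle A \<simeq> middle B" using t lower_low[of A] lower_low[of B] 1 assms(4) by simp
    then obtain x Z where Z: "A \<simeq> Z" "B \<simeq> insert x Z"
      using Phi_chain[OF _ assms(2-4) 1] by metis
    obtain W where "insert x Z \<simeq> W" "A \<subseteq> W" using lift_sub[OF orb_sym[OF Z(1)], of "insert x Z"] by blast
    then show thesis using that Z same_orbit_trans by metis
  next
    case 2
    have "card (lower A) = Suc (card (lower B))" "2 * card (lower A) \<le> m"
      using lower_card[OF assms(2)] lower_card[OF assms(3)] 2 assms(4) cB by auto
    then obtain x Z where Z: "lower B \<simeq> Z" "Z \<subseteq> X" "x \<in> free Z" "lower A \<simeq> insert x Z"
      using Phi_chain[OF orb_sym[OF t] lower_sub[OF assms(3)] lower_sub[OF assms(2)]] by metis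
    have A: "A \<simeq> theta (insert x Z)" using theta_equivariant[OF Z(4)] lower_theta assms 2 by simp
    have B: "B \<simeq> theta Z" using theta_equivariant[OF Z(1)] lower_theta assms 2 by simp
    \<comment> \<open>Reflection reverses the inclusion: \<open>x\<close> is free in
      \<open>Z\<close>, and every free point of the larger set is free in \<open>Z\<close> as
      well.\<close>
    have "theta (insert x Z) \<subseteq> theta Z"
      unfolding theta_def using free_antimono[of Z "insert x Z"] Z(3) by auto
    then obtain W where "theta Z \<simeq> W" "A \<subseteq> W" using lift_sub[OF orb_sym[OF A]] by metis
    then show thesis using that B same_orbit_trans by metis
  next
    case 3
    \<comment> \<open>The two middle ranks fold to the same rank, so the label identifies the folded
      orbits, and \<open>theta\<close> only adds points.\<close>
    have "lower A \<simeq> lower B"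
      using chain_id_lower[OF assms(1-3)] card_lower assms 3 by simp
    moreover have "lower A = A" using lower_low 3 by simp
    moreover have "lower B \<subseteq> B" using lower_theta[OF assms(3)] 3 assms(4) unfolding theta_def by auto
    ultimately show thesis using lift_sub[OF orb_sym] that by metis
  qed
qed

text \<open>Below the middle the witness is the reflected set, elsewhere the folded one; either way
  it folds to the same set as \<open>A\<close>.\<close>

lemma chain_id_flip:
  assumes "A \<subseteq> X" shows "\<exists>B\<subseteq>X. chain_id B = chain_id A \<and> card B = m - card A"
proof (cases "2 * card A < m")
  case True
  have c: "card (theta A) = m - card A" using card_theta assms True by simp
  have "lower (theta A) = A"
    using theta_inj[of "lower (theta A)" A] lower_theta[of "theta A"] lower_sub lower_card theta_sub
      assms c True by simp
  then show ?thesis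
    using c theta_sub[OF assms] lower_low[of A] True by (intro exI[of _ "theta A"]) (simp add: chain_id_def)
next
  case False
  then show ?thesis
    using lower_card[OF assms] lower_sub[OF assms] lower_low[of "lower A"]
    by (intro exI[of _ "lower A"]) (simp add: chain_id_def)
qed

lemma chain_id_up:
  assumes "A \<subseteq> X" "card A \<le> k" "2 * k \<le> m"
  shows "\<exists>B\<subseteq>X. chain_id B = chain_id A \<and> card B = k"
  using assms(2,3)
proof (induction k rule: dec_induct)
  case (step k)
  then obtain B where B: "B \<subseteq> X" "chain_id B = chain_id A" "card B = k" by auto
  have lt: "card B < m div 2" "2 * card B < m" using step B by auto
  have P: "Phi B \<subseteq> X" "card (Phi B) = Suc k" using Phi_sub_card[OF B(1) lt(2)] B(3) by auto
  have "lower (Phi B) = Phi B" "lower B = B" using lower_low P step B by auto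
  then have "chain_id (Phi B) = chain_id B" using middle_Phi[OF B(1) lt(1)] by (simp add: chain_id_def)
  then show ?case using P B(2) by auto
qed (use assms in auto)

lemma cycle_orbit_scd: "\<exists>c lo. orbit_scd X S c lo"
proof -
  \<comment> \<open>A chain starts in the least rank carrying its label; by reflection it ends in
    the complementary rank.\<close>
  define lo where "lo i = (LEAST k. \<exists>B\<subseteq>X. chain_id B = i \<and> card B = k)" for i
  have lo_le: "lo (chain_id A) \<le> card B" if "B \<subseteq> X" "chain_id B = chain_id A" for A B
    unfolding lo_def using that by (intro Least_le) auto
  have lo_ex: "\<exists>B\<subseteq>X. chain_id B = chain_id A \<and> card B = lo (chain_id A)" if "A \<subseteq> X" for A
    unfolding lo_def
    using LeastI_ex[of "\<lambda>k. \<exists>B\<subseteq>X. chain_id B = chain_id A \<and> card B = k"] that by blast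
  have "orbit_scd X S chain_id lo"
    unfolding orbit_scd_def
  proof (intro conjI ballI allI impI)
    fix s A assume "s \<in> S" "A \<subseteq> X"
    then have "s \<in> gen_group S" using gen_group.gen_mult[OF _ gen_group.gen_id, of s S] by simp
    then have "A \<simeq> s ` A" unfolding same_orbit_def by blast
    then show "chain_id (s ` A) = chain_id A" using chain_id_cong \<open>A \<subseteq> X\<close> by simp
  next
    fix A B assume "A \<subseteq> X" "B \<subseteq> X" "chain_id A = chain_id B \<and> card A = card B"
    then show "A \<simeq> B" using chain_id_orb by blast
  next
    fix A B assume "A \<subseteq> X" "B \<subseteq> X" "chain_id A = chain_id B \<and> card B = Suc (card A)"
    then show "\<exists>B'. B \<simeq> B' \<and> A \<subseteq> B'" using chain_id_step by metis
  next
    fix A assume A: "A \<subseteq> X"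
    show "lo (chain_id A) \<le> card A" using lo_le[OF A] by simp
    obtain B where B: "B \<subseteq> X" "chain_id B = chain_id A" "card B = m - card A"
      using chain_id_flip[OF A] by auto
    then show "card A + lo (chain_id A) \<le> m"
      using lo_le[OF B(1,2)] card_mono[OF finX A] by simp
  next
    fix A k assume A: "A \<subseteq> X" and k: "lo (chain_id A) \<le> k \<and> k + lo (chain_id A) \<le> m"
    obtain L where L: "L \<subseteq> X" "chain_id L = chain_id A" "card L = lo (chain_id A)"
      using lo_ex[OF A] by auto
    show "\<exists>B\<subseteq>X. chain_id B = chain_id A \<and> card B = k"
    proof (cases "2 * k \<le> m")
      case True
      then show ?thesis using chain_id_up[OF L(1), of k] L k by simp
    next
      case False
      \<comment> \<open>An upper rank is reached by climbing from the bottom to \<open>m - k\<close>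
        and reflecting.\<close>
      then have "lo (chain_id A) \<le> m - k" "2 * (m - k) \<le> m" using k by linarith+
      then obtain B where B: "B \<subseteq> X" "chain_id B = chain_id A" "card B = m - k"
        using chain_id_up[OF L(1), of "m - k"] L by auto
      then show ?thesis using chain_id_flip[OF B(1)] k by (simp add: diff_diff_cancel)
    qed
  qed
  then show ?thesis by blast
qed

end

section \<open>Cycles given by lists, and their integer powers\<close>

lemma cycle_bij_betw:
  assumes "distinct cs" "b \<in> set cs"
  shows "bij_betw (\<lambda>k. (cycle_of_list cs ^^ k) b) {..<card (set cs)} (set cs)"
proof -
  let ?n = "length cs"
  obtain i where i: "i < ?n" "b = cs ! i" using assms(2) by (metis in_set_conv_nth)
  \<comment> \<open>On indices a power of the cycle is a shift modulo the length.\<close>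
  have pow: "(cycle_of_list cs ^^ k) b = cs ! ((k + i) mod ?n)" for k
    using cyclic_rotation[OF assms(1), of k] i nth_rotate[of i cs k] by (metis nth_map)
  have lt: "j mod ?n < ?n" for j using i(1) by (intro mod_less_divisor) linarith
  have inj: "inj_on (\<lambda>k. (cycle_of_list cs ^^ k) b) {..<?n}"
  proof (rule linorder_inj_onI)
    fix k l assume kl: "k < l" "k \<in> {..<?n}" "l \<in> {..<?n}"
    show "(cycle_of_list cs ^^ k) b \<noteq> (cycle_of_list cs ^^ l) b"
    proof
      assume "(cycle_of_list cs ^^ k) b = (cycle_of_list cs ^^ l) b"
      then have "(l + i) mod ?n = (k + i) mod ?n"
        using assms(1) lt unfolding pow by (subst (asm) nth_eq_iff_index_eq) auto
      then have "?n dvd l - k" using kl mod_eq_dvd_iff_nat[of "k + i" "l + i" ?n] by simp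
      then show False using kl by (auto dest: dvd_imp_le)
    qed
  qed auto
  have "(\<lambda>k. (cycle_of_list cs ^^ k) b) ` {..<?n} = set cs"
  proof (rule card_subset_eq)
    show "(\<lambda>k. (cycle_of_list cs ^^ k) b) ` {..<?n} \<subseteq> set cs"
      unfolding pow using lt by auto
  qed (use card_image[OF inj] distinct_card[OF assms(1)] in auto)
  then show ?thesis using inj distinct_card[OF assms(1)] by (simp add: bij_betw_def)
qed

lemma perm_zpow_permutes: "s permutes X \<Longrightarrow> perm_zpow s k permutes X"
  unfolding perm_zpow_def by (simp add: permutes_funpow permutes_inv)

lemma perm_zpow_comm:
  assumes "s permutes X" shows "perm_zpow s k \<circ> s = s \<circ> perm_zpow s k"
proof -
  have "((inv s) ^^ j) \<circ> s = s \<circ> (inv s) ^^ j" for j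
  proof (induction j)
    case (Suc j)
    have "((inv s) ^^ Suc j) \<circ> s = inv s \<circ> ((inv s) ^^ j \<circ> s)" by (simp add: comp_assoc)
    also have "\<dots> = (inv s \<circ> s) \<circ> (inv s) ^^ j" by (simp only: Suc comp_assoc)
    also have "\<dots> = (s \<circ> inv s) \<circ> (inv s) ^^ j" using permutes_inv_o[OF assms] by simp
    finally show ?case by (simp only: funpow.simps comp_assoc)
  qed simp
  moreover have "(s ^^ j) \<circ> s = s \<circ> s ^^ j" for j by (simp add: fun_eq_iff funpow_swap1)
  ultimately show ?thesis unfolding perm_zpow_def by simp
qed

lemma orbit_scd_empty: "orbit_scd {} S (\<lambda>_. 0) (\<lambda>_. 0)"
  by (simp add: orbit_scd_def same_orbit_refl)

lemma cycle_list_orbit_scd: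
  assumes "distinct cs" "\<And>s. s \<in> S \<Longrightarrow> s permutes set cs"
    "\<And>s. s \<in> S \<Longrightarrow> s \<circ> cycle_of_list cs = cycle_of_list cs \<circ> s"
  shows "\<exists>c lo. orbit_scd (set cs) S c lo"
proof (cases "cs = []")
  case True
  then show ?thesis using orbit_scd_empty by auto
next
  case False
  interpret cycle_action "set cs" "cycle_of_list cs" S
    using assms False cycle_bij_betw cycle_permutes by unfold_locales auto
  show ?thesis using cycle_orbit_scd .
qed

text \<open>A list with at most one entry denotes the identity, whose support is empty; replacing it
  by the empty list makes the support equal to the set of the list.\<close>

lemma is_cycle_in_supp:
  assumes "is_cycle_in n s"
  obtains cs where "distinct cs" "supp_perm s = set cs" "s = cycle_of_list cs"
proof -
  obtain cs where cs: "distinct cs" "s = cycle_of_list cs"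
    using assms unfolding is_cycle_in_def by auto
  show thesis
  proof (cases "length cs \<le> 1")
    case True
    then have "s = id" using cs(2) by (cases cs) auto
    then show thesis using that[of "[]"] by (simp add: supp_perm_def)
  next
    case False
    have "s b \<noteq> b" if b: "b \<in> set cs" for b
    proof
      assume "s b = b"
      then have "(s ^^ 1) b = (s ^^ 0) b" by simp
      moreover have "cs \<noteq> []" using b by auto
      ultimately show False
        using inj_onD[OF bij_betw_imp_inj_on[OF cycle_bij_betw[OF cs(1) b]], of 1 0]
          False distinct_card[OF cs(1)] cs(2) by auto
    qed
    then have "supp_perm s = set cs"
      using id_outside_supp[of _ cs] cs(2) unfolding supp_perm_def by auto
    then show thesis using that cs by simp
  qed
qed

section \<open>Products\<close>

lemma orbit_scdD:
  assumes "orbit_scd X S c lo" "A \<subseteq> X"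
  shows "s \<in> S \<Longrightarrow> c (s ` A) = c A"
    and "B \<subseteq> X \<Longrightarrow> c A = c B \<Longrightarrow> card A = card B \<Longrightarrow> same_orbit S A B"
    and "B \<subseteq> X \<Longrightarrow> c A = c B \<Longrightarrow> card B = Suc (card A) \<Longrightarrow> \<exists>B'. same_orbit S B B' \<and> A \<subseteq> B'"
    and "lo (c A) \<le> card A" "card A + lo (c A) \<le> card X"
    and "lo (c A) \<le> k \<Longrightarrow> k + lo (c A) \<le> card X \<Longrightarrow> \<exists>B\<subseteq>X. c B = c A \<and> card B = k"
proof -
  note d = assms(1)[unfolded orbit_scd_def]
  note d1 = conjunct1[OF d, rule_format] and d2 = conjunct1[OF conjunct2[OF d], rule_format]
    and d3 = conjunct1[OF conjunct2[OF conjunct2[OF d]], rule_format]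
    and d4 = conjunct2[OF conjunct2[OF conjunct2[OF d]], rule_format]
  show "s \<in> S \<Longrightarrow> c (s ` A) = c A" using d1 assms(2) by simp
  show "B \<subseteq> X \<Longrightarrow> c A = c B \<Longrightarrow> card A = card B \<Longrightarrow> same_orbit S A B"
    using d2 assms(2) by simp
  show "B \<subseteq> X \<Longrightarrow> c A = c B \<Longrightarrow> card B = Suc (card A) \<Longrightarrow> \<exists>B'. same_orbit S B B' \<and> A \<subseteq> B'"
    using d3[OF assms(2)] by simp
  show "lo (c A) \<le> card A" "card A + lo (c A) \<le> card X" using d4[OF assms(2)] by simp_all
  show "lo (c A) \<le> k \<Longrightarrow> k + lo (c A) \<le> card X \<Longrightarrow> \<exists>B\<subseteq>X. c B = c A \<and> card B = k"
    using d4[OF assms(2)] by simp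
qed

lemma same_orbit_subset:
  assumes "same_orbit S A B" "\<And>s. s \<in> S \<Longrightarrow> s permutes X" "A \<subseteq> X" shows "B \<subseteq> X"
  using assms gen_group_permutes unfolding same_orbit_def by (metis image_mono permutes_image)

lemma permutes_image_disjoint:
  assumes "g permutes X" "A \<inter> X = {}" shows "g ` A = A"
proof -
  have "g a = a" if "a \<in> A" for a using that assms by (intro permutes_not_in[OF assms(1)]) auto
  then show ?thesis by (simp cong: image_cong)
qed

text \<open>Elements of either group fix the other block pointwise, so one composite performs both
  motions.\<close>

lemma same_orbit_Un:
  assumes "same_orbit S A A'" "same_orbit T B B'" "X \<inter> Y = {}"
    "\<And>s. s \<in> S \<Longrightarrow> s permutes X" "\<And>s. s \<in> T \<Longrightarrow> s permutes Y" "A \<subseteq> X" "B \<subseteq> Y"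
  shows "same_orbit (S \<union> T) (A \<union> B) (A' \<union> B')"
proof -
  obtain g h where gh: "g \<in> gen_group S" "A' = g ` A" "h \<in> gen_group T" "B' = h ` B"
    using assms(1,2) unfolding same_orbit_def by auto
  have "B' \<subseteq> Y" using same_orbit_subset[OF assms(2,5,7)] .
  then have "g ` B' = B'" "h ` A = A"
    using permutes_image_disjoint gen_group_permutes[OF gh(1) assms(4)]
      gen_group_permutes[OF gh(3) assms(5)] assms(3,6) by (metis Int_commute disjoint_iff subsetD)+
  then have "(g \<circ> h) ` (A \<union> B) = A' \<union> B'" using gh by (auto simp: image_Un simp flip: image_image)
  moreover have "g \<circ> h \<in> gen_group (S \<union> T)"
    using gen_group_comp gen_group_mono[of S "S \<union> T"] gen_group_mono[of T "S \<union> T"] gh by blast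
  ultimately show ?thesis unfolding same_orbit_def by metis
qed

text \<open>Put \<open>p = a1 - l1\<close> and \<open>u = y - l2 - a2\<close>. The hook fixes
  \<open>min p u\<close> and the total rank fixes the difference of \<open>p\<close> and
  \<open>u\<close>, so together they fix the pair. Raising the difference by one at equal minimum
  moves just one coordinate.\<close>

lemma hook_step:
  fixes a1 a2 b1 b2 l1 l2 y :: nat
  assumes "min (a1 - l1) (y - l2 - a2) = min (b1 - l1) (y - l2 - b2)"
    and "l1 \<le> a1" "l1 \<le> b1" "a2 + l2 \<le> y" "b2 + l2 \<le> y"
  shows "b1 + b2 = a1 + a2 \<Longrightarrow> a1 = b1 \<and> a2 = b2"
    and "b1 + b2 = Suc (a1 + a2) \<Longrightarrow> b1 = Suc a1 \<and> a2 = b2 \<or> a1 = b1 \<and> b2 = Suc a2"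
proof -
  obtain p p' where p: "a1 = l1 + p" "b1 = l1 + p'" using assms(2,3) by (auto simp: le_iff_add)
  obtain u where u: "y = a2 + l2 + u" using assms(4) by (auto simp: le_iff_add)
  obtain u' where u': "y = b2 + l2 + u'" using assms(5) by (auto simp: le_iff_add)
  have "y - l2 - a2 = u" "y - l2 - b2 = u'" using u u' by linarith+
  then have m: "min p u = min p' u'" using assms(1) p by simp
  have au: "a2 + u = b2 + u'" using u u' by simp
  show "b1 + b2 = a1 + a2 \<Longrightarrow> a1 = b1 \<and> a2 = b2"
    using m au p by (auto simp: min_def split: if_splits)
  show "b1 + b2 = Suc (a1 + a2) \<Longrightarrow> b1 = Suc a1 \<and> a2 = b2 \<or> a1 = b1 \<and> b2 = Suc a2"
    using m au p by (auto simp: min_def split: if_splits)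
qed

lemma hook_point:
  fixes a1 a2 l1 l2 x y k :: nat
  defines "h \<equiv> min (a1 - l1) (y - l2 - a2)"
  assumes "l1 \<le> a1" "a1 + l1 \<le> x" "l2 \<le> a2" "a2 + l2 \<le> y"
    and "l1 + l2 + h \<le> k" "k + l1 + l2 + h \<le> x + y"
  obtains p q where "k = l1 + p + (l2 + q)" "l1 + p + l1 \<le> x" "l2 + q + l2 \<le> y"
    "min p (y - l2 - (l2 + q)) = h"
proof -
  define K where "K = y - l2 - l2"
  have y: "y = K + l2 + l2" using assms(4,5) by (simp add: K_def)
  have h: "h \<le> K" "h + l1 + l1 \<le> x" unfolding h_def using y assms(2-5) by auto
  obtain e where e: "k = l1 + l2 + h + e" using assms(6) by (auto simp: le_iff_add)
  show thesis
  proof (cases "h + e \<le> K")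
    case True
    \<comment> \<open>First leg of the hook: \<open>p\<close> rests at \<open>h\<close> while
      \<open>q\<close> climbs to \<open>K - h\<close>.\<close>
    show thesis by (rule that[of h e]) (use e h y True in auto)
  next
    case False
    \<comment> \<open>Second leg: \<open>q\<close> rests at \<open>K - h\<close> and
      \<open>p\<close> absorbs the remaining steps.\<close>
    show thesis by (rule that[of "h + e - (K - h)" "K - h"]) (use e h y False assms(7) in auto)
  qed
qed

text \<open>A product of two chains of lengths \<open>K1\<close>, \<open>K2\<close> splits into symmetric hooks: the pair with
  offsets \<open>(p, q)\<close> lies on the hook of index \<open>min p (K2 - q)\<close>.\<close>
lemma orbit_scd_Un:
  assumes XS: "orbit_scd X S c1 lo1" and YT: "orbit_scd Y T c2 lo2" and disj: "X \<inter> Y = {}"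
    and fin: "finite X" "finite Y"
    and perm: "\<And>s. s \<in> S \<Longrightarrow> s permutes X" "\<And>s. s \<in> T \<Longrightarrow> s permutes Y"
  shows "\<exists>c lo. orbit_scd (X \<union> Y) (S \<union> T) c lo"
proof -
  define h where "h A = min (card (A \<inter> X) - lo1 (c1 (A \<inter> X)))
    (card Y - lo2 (c2 (A \<inter> Y)) - card (A \<inter> Y))" for A
  define c where "c A = prod_encode (c1 (A \<inter> X), prod_encode (c2 (A \<inter> Y), h A))" for A
  \<comment> \<open>A hook of index \<open>k\<close> begins at the offsets \<open>(k, 0)\<close>,
    hence the summand \<open>k\<close> in its starting rank.\<close>
  define lo where "lo i = (let (i1, j) = prod_decode i; (i2, k) = prod_decode j in lo1 i1 + lo2 i2 + k)"
    for i
  have lo: "lo (c A) = lo1 (c1 (A \<inter> X)) + lo2 (c2 (A \<inter> Y)) + h A" for A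
    by (simp add: lo_def c_def)
  have card: "card A = card (A \<inter> X) + card (A \<inter> Y)" if "A \<subseteq> X \<union> Y" for A
  proof -
    have "A = (A \<inter> X) \<union> (A \<inter> Y)" using that by auto
    moreover have "(A \<inter> X) \<inter> (A \<inter> Y) = {}" using disj by auto
    ultimately show ?thesis using fin by (metis card_Un_disjoint finite_Int)
  qed
  have cXY: "card (X \<union> Y) = card X + card Y" using card_Un_disjoint fin disj by blast
  note b1 = orbit_scdD(4,5)[OF XS Int_lower2] and b2 = orbit_scdD(4,5)[OF YT Int_lower2]
  have split: "A = (A \<inter> X) \<union> (A \<inter> Y)" if "A \<subseteq> X \<union> Y" for A using that by auto
  have "orbit_scd (X \<union> Y) (S \<union> T) c lo"
    unfolding orbit_scd_def
  proof (intro conjI ballI allI impI)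
    fix s A assume s: "s \<in> S \<union> T" and A: "A \<subseteq> X \<union> Y"
    have inj: "inj s" using s perm permutes_inj by blast
    from s show "c (s ` A) = c A"
    proof
      assume s: "s \<in> S"
      have "s ` X = X" using permutes_image perm(1)[OF s] by blast
      moreover have "s ` Y = Y" using permutes_image_disjoint[OF perm(1)[OF s], of Y] disj by auto
      ultimately have *: "s ` A \<inter> X = s ` (A \<inter> X)" "s ` A \<inter> Y = s ` (A \<inter> Y)"
        using image_Int[OF inj] by metis+
      have "s ` (A \<inter> Y) = A \<inter> Y"
        using permutes_image_disjoint[OF perm(1)[OF s], of "A \<inter> Y"] disj by auto
      moreover have "card (s ` (A \<inter> X)) = card (A \<inter> X)" using card_image inj inj_on_subset by blast
      ultimately show ?thesis
        using orbit_scdD(1)[OF XS Int_lower2 s] by (simp add: c_def h_def *)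
    next
      assume s: "s \<in> T"
      have "s ` Y = Y" using permutes_image perm(2)[OF s] by blast
      moreover have "s ` X = X" using permutes_image_disjoint[OF perm(2)[OF s], of X] disj by auto
      ultimately have *: "s ` A \<inter> X = s ` (A \<inter> X)" "s ` A \<inter> Y = s ` (A \<inter> Y)"
        using image_Int[OF inj] by metis+
      have "s ` (A \<inter> X) = A \<inter> X"
        using permutes_image_disjoint[OF perm(2)[OF s], of "A \<inter> X"] disj by auto
      moreover have "card (s ` (A \<inter> Y)) = card (A \<inter> Y)" using card_image inj inj_on_subset by blast
      ultimately show ?thesis
        using orbit_scdD(1)[OF YT Int_lower2 s] by (simp add: c_def h_def *)
    qed
  next
    fix A B assume A: "A \<subseteq> X \<union> Y" and B: "B \<subseteq> X \<union> Y" and eq: "c A = c B \<and> card A = card B"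
    have e: "c1 (A \<inter> X) = c1 (B \<inter> X)" "c2 (A \<inter> Y) = c2 (B \<inter> Y)" "h A = h B"
      using eq by (auto simp: c_def)
    have sum: "card (B \<inter> X) + card (B \<inter> Y) = card (A \<inter> X) + card (A \<inter> Y)" using eq card A B by simp
    have "card (A \<inter> X) = card (B \<inter> X) \<and> card (A \<inter> Y) = card (B \<inter> Y)"
      by (rule hook_step(1)[OF e(3)[unfolded h_def e(1,2)] b1(1)[of A, unfolded e(1)] b1(1)[of B]
            b2(2)[of A, unfolded e(2)] b2(2)[of B] sum])
    then have "same_orbit (S \<union> T) (A \<inter> X \<union> A \<inter> Y) (B \<inter> X \<union> B \<inter> Y)"
      using e orbit_scdD(2)[OF XS Int_lower2] orbit_scdD(2)[OF YT Int_lower2]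
      by (intro same_orbit_Un[OF _ _ disj perm]) auto
    then show "same_orbit (S \<union> T) A B" using split A B by metis
  next
    fix A B assume A: "A \<subseteq> X \<union> Y" and B: "B \<subseteq> X \<union> Y" and eq: "c A = c B \<and> card B = Suc (card A)"
    have e: "c1 (A \<inter> X) = c1 (B \<inter> X)" "c2 (A \<inter> Y) = c2 (B \<inter> Y)" "h A = h B"
      using eq by (auto simp: c_def)
    have sum: "card (B \<inter> X) + card (B \<inter> Y) = Suc (card (A \<inter> X) + card (A \<inter> Y))" using eq card A B by simp
    have "card (B \<inter> X) = Suc (card (A \<inter> X)) \<and> card (A \<inter> Y) = card (B \<inter> Y) \<or>
        card (A \<inter> X) = card (B \<inter> X) \<and> card (B \<inter> Y) = Suc (card (A \<inter> Y))"
      by (rule hook_step(2)[OF e(3)[unfolded h_def e(1,2)] b1(1)[of A, unfolded e(1)] b1(1)[of B]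
            b2(2)[of A, unfolded e(2)] b2(2)[of B] sum])
    \<comment> \<open>In one factor the chain supplies a member of the orbit above the part of
      \<open>A\<close>; in the other factor the two parts share an orbit.\<close>
    then obtain B1 B2 where "same_orbit S (B \<inter> X) B1" "same_orbit T (B \<inter> Y) B2"
      "A \<inter> X \<subseteq> B1" "A \<inter> Y \<subseteq> B2"
    proof (elim disjE conjE)
      assume *: "card (B \<inter> X) = Suc (card (A \<inter> X))" "card (A \<inter> Y) = card (B \<inter> Y)"
      then show thesis
        using orbit_scdD(3)[OF XS Int_lower2 Int_lower2 e(1)]
          orbit_scdD(2)[OF YT Int_lower2 Int_lower2 e(2)[symmetric]] that by (metis order_refl)
    next
      assume *: "card (A \<inter> X) = card (B \<inter> X)" "card (B \<inter> Y) = Suc (card (A \<inter> Y))"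
      then show thesis
        using orbit_scdD(3)[OF YT Int_lower2 Int_lower2 e(2)]
          orbit_scdD(2)[OF XS Int_lower2 Int_lower2 e(1)[symmetric]] that by (metis order_refl)
    qed
    then have "same_orbit (S \<union> T) (B \<inter> X \<union> B \<inter> Y) (B1 \<union> B2)" "A \<subseteq> B1 \<union> B2"
      using split[OF A] by (auto intro!: same_orbit_Un[OF _ _ disj perm])
    then show "\<exists>B'. same_orbit (S \<union> T) B B' \<and> A \<subseteq> B'" using split[OF B] by metis
  next
    fix A assume A: "A \<subseteq> X \<union> Y"
    show "lo (c A) \<le> card A" "card A + lo (c A) \<le> card (X \<union> Y)"
      using b1[of A] b2[of A] unfolding lo cXY card[OF A] h_def by linarith+
  next
    fix A k assume A: "A \<subseteq> X \<union> Y" and k: "lo (c A) \<le> k \<and> k + lo (c A) \<le> card (X \<union> Y)"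
    define l1 l2 where "l1 = lo1 (c1 (A \<inter> X))" and "l2 = lo2 (c2 (A \<inter> Y))"
    have b: "l1 \<le> card (A \<inter> X)" "card (A \<inter> X) + l1 \<le> card X"
      "l2 \<le> card (A \<inter> Y)" "card (A \<inter> Y) + l2 \<le> card Y"
      using b1[of A] b2[of A] unfolding l1_def l2_def by auto
    have hA: "h A = min (card (A \<inter> X) - l1) (card Y - l2 - card (A \<inter> Y))"
      by (simp add: h_def l1_def l2_def)
    have k': "l1 + l2 + h A \<le> k" "k + l1 + l2 + h A \<le> card X + card Y"
      using k unfolding lo cXY l1_def l2_def by auto
    obtain p q where pq: "k = l1 + p + (l2 + q)" "l1 + p + l1 \<le> card X" "l2 + q + l2 \<le> card Y"
      "min p (card Y - l2 - (l2 + q)) = h A"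
      using hook_point[OF b k'[unfolded hA]] unfolding hA by metis
    obtain B1 where B1: "B1 \<subseteq> X" "c1 B1 = c1 (A \<inter> X)" "card B1 = l1 + p"
      using orbit_scdD(6)[OF XS Int_lower2, of A "l1 + p"] pq(2) unfolding l1_def by auto
    obtain B2 where B2: "B2 \<subseteq> Y" "c2 B2 = c2 (A \<inter> Y)" "card B2 = l2 + q"
      using orbit_scdD(6)[OF YT Int_lower2, of A "l2 + q"] pq(3) unfolding l2_def by auto
    have *: "(B1 \<union> B2) \<inter> X = B1" "(B1 \<union> B2) \<inter> Y = B2" using B1 B2 disj by auto
    have sub: "B1 \<union> B2 \<subseteq> X \<union> Y" using B1 B2 by auto
    have "h (B1 \<union> B2) = h A"
      using pq(4) B1 B2 unfolding h_def[of "B1 \<union> B2"] * l1_def l2_def by simp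
    then have "c (B1 \<union> B2) = c A" using B1 B2 by (simp add: c_def *)
    moreover have "card (B1 \<union> B2) = k" using card[OF sub] B1 B2 pq(1) by (simp add: *)
    ultimately show "\<exists>B\<subseteq>X \<union> Y. c B = c A \<and> card B = k" using sub by blast
  qed
  then show ?thesis by blast
qed

section \<open>From labels to chains\<close>

lemma orbit_set_eq: "orbit_set (gen_group S) A = {B. same_orbit S A B}"
  unfolding orbit_set_def same_orbit_def by auto

text \<open>Every label yields one chain, listing the orbits of representatives rank by rank.
  Neighbours are comparable, and this is already a cover because a strict comparison raises the
  rank.\<close>

lemma is_SCO_if_orbit_scd:
  assumes scd: "orbit_scd {1..n} S c lo" and perm: "\<And>s. s \<in> S \<Longrightarrow> s permutes {1..n}"
  shows "is_SCO (quot_carrier n (gen_group S)) quot_le quot_rank n"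
proof -
  let ?X = "{1..n}" and ?O = "orbit_set (gen_group S)"
  let ?P = "quot_carrier n (gen_group S)"
  have sym: "same_orbit S A B \<Longrightarrow> same_orbit S B A" for A B
    using same_orbit_sym perm by blast
  have O_iff: "?O A = ?O B \<longleftrightarrow> same_orbit S A B" for A B
    unfolding orbit_set_eq using sym same_orbit_trans same_orbit_refl by blast
  have card_orb: "card B = card A" if "same_orbit S A B" for A B
    using that gen_group_permutes perm unfolding same_orbit_def
    by (metis card_image inj_on_subset permutes_inj subset_UNIV)
  have sub_orb: "B \<subseteq> ?X" if "same_orbit S A B" "A \<subseteq> ?X" for A B
    using same_orbit_subset[OF that(1) perm that(2)] .
  have c_gen: "c (g ` A) = c A" if "g \<in> gen_group S" "A \<subseteq> ?X" for g A
    using that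
  proof (induction rule: gen_group.induct)
    case (gen_mult s g)
    have "g ` A \<subseteq> ?X" using sub_orb gen_mult unfolding same_orbit_def by blast
    then show ?case using gen_mult orbit_scdD(1)[OF scd] by (simp flip: image_image add: image_comp[symmetric])
  next
    case (gen_inv s g)
    have "inv s \<circ> g \<in> gen_group S" using gen_inv gen_group.gen_inv by blast
    then have sub: "(inv s \<circ> g) ` A \<subseteq> ?X" using sub_orb gen_inv(4) unfolding same_orbit_def by blast
    \<comment> \<open>Invariance is given for \<open>s\<close>, so it is applied to the set moved by
      \<open>inv s\<close>, which \<open>s\<close> carries back.\<close>
    have "s ` (inv s \<circ> g) ` A = g ` A"
      using perm[OF gen_inv(1)] by (simp add: image_image permutes_inverses)
    then show ?case using orbit_scdD(1)[OF scd sub gen_inv(1)] gen_inv(3,4) by simp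
  qed simp
  have c_orb: "c A = c B" if "same_orbit S A B" "A \<subseteq> ?X" for A B
    using that c_gen unfolding same_orbit_def by metis
  have rank: "quot_rank (?O A) = card A" for A
  proof -
    have "A \<in> ?O A" using same_orbit_refl by (simp add: orbit_set_eq)
    then have "(SOME X. X \<in> ?O A) \<in> ?O A" by (rule someI)
    then show ?thesis unfolding quot_rank_def using card_orb by (simp add: orbit_set_eq)
  qed
  have le_card: "card A < card B \<or> ?O A = ?O B" if le: "quot_le (?O A) (?O B)" "B \<subseteq> ?X" for A B
  proof -
    obtain A' B' where AB: "same_orbit S A A'" "same_orbit S B B'" "A' \<subseteq> B'"
      using le(1) unfolding quot_le_def orbit_set_eq by auto
    have "finite B'" using sub_orb[OF AB(2) le(2)] finite_subset by blast
    then have "card A' < card B' \<or> A' = B'" using AB(3) by (metis psubset_card_mono psubsetI)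
    then show ?thesis
    proof
      assume "A' = B'"
      then have "same_orbit S A B" using AB(1,2) sym same_orbit_trans by blast
      then show ?thesis using O_iff by blast
    qed (use card_orb[OF AB(1)] card_orb[OF AB(2)] in simp)
  qed
  have covers: "covers ?P quot_le (?O A) (?O B)"
    if AB: "A \<subseteq> ?X" "B \<subseteq> ?X" "c A = c B" "card B = Suc (card A)" for A B
    unfolding covers_def
  proof (intro conjI notI)
    show "?O A \<in> ?P" "?O B \<in> ?P" using AB unfolding quot_carrier_def by auto
    obtain B' where "same_orbit S B B'" "A \<subseteq> B'" using orbit_scdD(3)[OF scd AB] by auto
    then show "quot_le (?O A) (?O B)"
      unfolding quot_le_def orbit_set_eq using same_orbit_refl by blast
    show "?O A = ?O B \<Longrightarrow> False" using O_iff card_orb AB(4) by force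
    assume "\<exists>z\<in>?P. quot_le (?O A) z \<and> quot_le z (?O B) \<and> z \<noteq> ?O A \<and> z \<noteq> ?O B"
    then obtain Z where Z: "Z \<subseteq> ?X" "quot_le (?O A) (?O Z)" "quot_le (?O Z) (?O B)"
      "?O Z \<noteq> ?O A" "?O Z \<noteq> ?O B" unfolding quot_carrier_def by auto
    then show False using le_card[OF Z(2,1)] le_card[OF Z(3) AB(2)] AB(4) by simp
  qed
  define rep where "rep i k = (SOME B. B \<subseteq> ?X \<and> c B = i \<and> card B = k)" for i k
  have rep: "rep i k \<subseteq> ?X" "c (rep i k) = i" "card (rep i k) = k"
    if i: "i \<in> c ` Pow ?X" "lo i \<le> k" "k + lo i \<le> n" for i k
  proof -
    obtain A where A: "A \<subseteq> ?X" "i = c A" using i(1) by auto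
    have "\<exists>B. B \<subseteq> ?X \<and> c B = i \<and> card B = k"
      using orbit_scdD(6)[OF scd A(1), of k] i A(2) by auto
    from someI_ex[OF this] show "rep i k \<subseteq> ?X" "c (rep i k) = i" "card (rep i k) = k"
      unfolding rep_def by auto
  qed
  \<comment> \<open>The \<open>Suc\<close> makes the half-open list include the top rank
    \<open>n - lo i\<close>.\<close>
  define chain where "chain i = map (\<lambda>k. ?O (rep i k)) [lo i..<Suc (n - lo i)]" for i
  have lo: "2 * lo i \<le> n" if i: "i \<in> c ` Pow ?X" for i
  proof -
    obtain A where "A \<subseteq> ?X" "i = c A" using i by auto
    then show ?thesis using orbit_scdD(4,5)[OF scd, of A] by simp
  qed
  have set_chain: "set (chain i) = {?O (rep i k) | k. lo i \<le> k \<and> k + lo i \<le> n}" if "2 * lo i \<le> n" for i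
    using that unfolding chain_def by (auto simp: image_def)
  have chain_sub: "set (chain i) \<subseteq> ?P" if i: "i \<in> c ` Pow ?X" for i
  proof
    fix z assume "z \<in> set (chain i)"
    then obtain k where "z = ?O (rep i k)" "lo i \<le> k" "k + lo i \<le> n"
      unfolding set_chain[OF lo[OF i]] by blast
    then show "z \<in> ?P" using rep(1)[OF i] unfolding quot_carrier_def by blast
  qed
  have "is_SCD ?P quot_le quot_rank n (chain ` c ` Pow ?X)"
    unfolding is_SCD_def
  proof (intro conjI)
    show "\<forall>xs\<in>chain ` c ` Pow ?X. symmetric_chain ?P quot_le quot_rank n xs"
    proof
      fix xs assume "xs \<in> chain ` c ` Pow ?X"
      then obtain i where i: "i \<in> c ` Pow ?X" "xs = chain i" by blast
      note l = lo[OF i(1)]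
      have ne: "[lo i..<Suc (n - lo i)] \<noteq> []" using l by simp
      have nth: "xs ! j = ?O (rep i (lo i + j))" if j: "j < length xs" for j
      proof -
        have "lo i + j < Suc (n - lo i)" using j i(2) by (simp add: chain_def del: upt_Suc)
        then have "[lo i..<Suc (n - lo i)] ! j = lo i + j" by (rule nth_upt)
        then show ?thesis using j i(2) by (simp add: chain_def del: upt_Suc)
      qed
      have "covers ?P quot_le (xs ! j) (xs ! Suc j)" if "Suc j < length xs" for j
      proof -
        have j: "Suc (lo i + j) + lo i \<le> n"
          using that i(2) l unfolding chain_def by (simp del: upt_Suc)
        show ?thesis
          using nth[of j] nth[of "Suc j"] that rep[OF i(1), of "lo i + j"]
            rep[OF i(1), of "Suc (lo i + j)"] j by (simp add: covers)
      qed
      moreover have "set xs \<subseteq> ?P" using i chain_sub by simp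
      moreover have "quot_rank (hd xs) + quot_rank (last xs) = n"
      proof -
        have "hd xs = ?O (rep i (lo i))" "last xs = ?O (rep i (n - lo i))"
          using i(2) ne l unfolding chain_def by (simp_all add: hd_map last_map del: upt_Suc)
        then show ?thesis using rep(3)[OF i(1)] rank l by simp
      qed
      ultimately show "symmetric_chain ?P quot_le quot_rank n xs"
        unfolding symmetric_chain_def using i(2) ne by (simp add: chain_def del: upt_Suc)
    qed
    show "\<forall>xs\<in>chain ` c ` Pow ?X. \<forall>ys\<in>chain ` c ` Pow ?X. xs \<noteq> ys \<longrightarrow> set xs \<inter> set ys = {}"
    proof (intro ballI impI)
      fix xs ys assume "xs \<in> chain ` c ` Pow ?X" "ys \<in> chain ` c ` Pow ?X" and neq: "xs \<noteq> ys"
      then obtain i j where i: "i \<in> c ` Pow ?X" "xs = chain i" and j: "j \<in> c ` Pow ?X" "ys = chain j"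
        by blast
      show "set xs \<inter> set ys = {}"
      proof (rule ccontr)
        assume "set xs \<inter> set ys \<noteq> {}"
        then obtain k l where kl: "?O (rep i k) = ?O (rep j l)" "lo i \<le> k" "k + lo i \<le> n"
          "lo j \<le> l" "l + lo j \<le> n"
          using set_chain[OF lo[OF i(1)]] set_chain[OF lo[OF j(1)]] i(2) j(2) by auto
        \<comment> \<open>A shared orbit carries a single label, so both chains have the same
          index.\<close>
        then have "c (rep i k) = c (rep j l)" using c_orb O_iff rep(1)[OF i(1)] by metis
        then have "i = j" using rep(2)[OF i(1) kl(2,3)] rep(2)[OF j(1) kl(4,5)] by simp
        then show False using neq i j by simp
      qed
    qed
    show "(\<Union>xs\<in>chain ` c ` Pow ?X. set xs) = ?P"
    proof
      show "(\<Union>xs\<in>chain ` c ` Pow ?X. set xs) \<subseteq> ?P" using chain_sub by blast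
      show "?P \<subseteq> (\<Union>xs\<in>chain ` c ` Pow ?X. set xs)"
      proof
        fix z assume "z \<in> ?P"
        then obtain A where A: "A \<subseteq> ?X" "z = ?O A" unfolding quot_carrier_def by auto
        have i: "c A \<in> c ` Pow ?X" using A by auto
        have b: "lo (c A) \<le> card A" "card A + lo (c A) \<le> n" using orbit_scdD(4,5)[OF scd A(1)] by auto
        have "same_orbit S A (rep (c A) (card A))"
          using orbit_scdD(2)[OF scd A(1)] rep[OF i b] by simp
        then have "z = ?O (rep (c A) (card A))" using O_iff A(2) by simp
        then have "z \<in> set (chain (c A))" using set_chain[OF lo[OF i]] b by blast
        then show "z \<in> (\<Union>xs\<in>chain ` c ` Pow ?X. set xs)" using i by blast
      qed
    qed
  qed
  then show ?thesis unfolding is_SCO_def by blast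
qed

theorem theorem2p1:
  fixes n t :: nat and \<sigma> :: "nat \<Rightarrow> nat \<Rightarrow> nat" and r :: "nat \<Rightarrow> int"
    and G :: "(nat \<Rightarrow> nat) set"
  assumes "n \<ge> 1"
    and "\<forall>i<t. is_cycle_in n (\<sigma> i)"
    and "\<forall>i<t. \<forall>j<t. i \<noteq> j \<longrightarrow> supp_perm (\<sigma> i) \<inter> supp_perm (\<sigma> j) = {}"
    and "G = gen_group {perm_zpow (\<sigma> i) (r i) | i. i < t}"
  shows "is_SCO (quot_carrier n G) quot_le quot_rank n"
proof -
  \<comment> \<open>Prefixes of the family of cycles, so that one factor is added at a time.\<close>
  define S where "S k = {perm_zpow (\<sigma> i) (r i) | i. i < k}" for k
  define Z where "Z k = (\<Union>i<k. supp_perm (\<sigma> i))" for k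
  have sub: "supp_perm (\<sigma> i) \<subseteq> {1..n}" if "i < t" for i
    using assms(2) that permutes_not_in unfolding is_cycle_in_def supp_perm_def by fastforce
  have perm: "perm_zpow (\<sigma> i) (r i) permutes supp_perm (\<sigma> i)" if "i < t" for i
    using is_cycle_in_supp[of n "\<sigma> i"] assms(2) that
    by (metis cycle_permutes perm_zpow_permutes)
  have SZ: "s permutes Z k" if sk: "s \<in> S k" "k \<le> t" for s k
  proof -
    obtain i where i: "i < k" "s = perm_zpow (\<sigma> i) (r i)" using sk(1) unfolding S_def by auto
    then show ?thesis
      using perm[of i] sk(2) unfolding Z_def by (auto intro: permutes_subset)
  qed
  have ZX: "Z k \<subseteq> {1..n}" if "k \<le> t" for k
    unfolding Z_def
  proof (rule UN_least)
    show "i \<in> {..<k} \<Longrightarrow> supp_perm (\<sigma> i) \<subseteq> {1..n}" for i using sub[of i] that by simp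
  qed
  have "\<exists>c lo. orbit_scd (Z k) (S k) c lo" if "k \<le> t" for k
    using that
  proof (induction k)
    case 0
    then show ?case using orbit_scd_empty by (auto simp: Z_def)
  next
    case (Suc k)
    then have k: "k < t" by simp
    obtain cs where cs: "distinct cs" "supp_perm (\<sigma> k) = set cs" "\<sigma> k = cycle_of_list cs"
      using is_cycle_in_supp assms(2) k by metis
    have p: "s permutes supp_perm (\<sigma> k)" if "s \<in> {perm_zpow (\<sigma> k) (r k)}" for s
      using perm[OF k] that by simp
    obtain c2 lo2 where 2: "orbit_scd (supp_perm (\<sigma> k)) {perm_zpow (\<sigma> k) (r k)} c2 lo2"
      using cycle_list_orbit_scd[OF cs(1), of "{perm_zpow (\<sigma> k) (r k)}"] p cs(2,3)
        perm_zpow_comm[OF cycle_permutes, of cs "r k"] by auto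
    obtain c1 lo1 where 1: "orbit_scd (Z k) (S k) c1 lo1" using Suc by auto
    have "Z k \<inter> supp_perm (\<sigma> k) = {}"
    proof -
      have "supp_perm (\<sigma> i) \<inter> supp_perm (\<sigma> k) = {}" if "i < k" for i using assms(3) k that by simp
      then show ?thesis unfolding Z_def by blast
    qed
    moreover have "finite (Z k)" "finite (supp_perm (\<sigma> k))"
      using ZX[of k] sub[OF k] k finite_subset by auto
    moreover have "Z (Suc k) = Z k \<union> supp_perm (\<sigma> k)" "S (Suc k) = S k \<union> {perm_zpow (\<sigma> k) (r k)}"
      unfolding Z_def S_def by (auto simp: less_Suc_eq)
    ultimately show ?case using orbit_scd_Un[OF 1 2 _ _ _ SZ p] k by simp
  qed
  then obtain c1 lo1 where 1: "orbit_scd (Z t) (S t) c1 lo1" by blast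
  \<comment> \<open>The points moved by none of the cycles form a last factor, treated as one more
    cycle on which no generator acts.\<close>
  let ?R = "{1..n} - Z t"
  obtain c2 lo2 where 2: "orbit_scd ?R {} c2 lo2"
    using cycle_list_orbit_scd[of "sorted_list_of_set ?R" "{}"] by auto
  have "\<exists>c lo. orbit_scd (Z t \<union> ?R) (S t \<union> {}) c lo"
    using ZX[of t] finite_subset by (intro orbit_scd_Un[OF 1 2]) (auto intro: SZ)
  moreover have "Z t \<union> ?R = {1..n}" using ZX by auto
  ultimately obtain c lo where scd: "orbit_scd {1..n} (S t) c lo" by auto
  have "s permutes {1..n}" if "s \<in> S t" for s
    using permutes_subset[OF SZ[OF that] ZX] by simp
  then have "is_SCO (quot_carrier n (gen_group (S t))) quot_le quot_rank n"
    by (rule is_SCO_if_orbit_scd[OF scd])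
  then show ?thesis using assms(4) by (simp add: S_def)
qed

end
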